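(* Let $n\in\mathbb{N}$, $\beta\in(0,1)$, and let $\{\hat\xi_v\}_{v\in\mathbb{Z}^2}$ be i.i.d. with $\mathbb{P}(\hat\xi_v=j)=(1-\beta)\beta^j$, $j\in\mathbb{Z}_{\ge0}$. For any $\{p^k_{(a,b)}\}_{(a,b,k)\in I_n\cup I_{n+1}}\in\mathscr{I}$, \[\mathbb{P}\big[\hat W^k_{(a,b)}=p^k_{(a,b)}\ \forall(a,b,k)\in I_n\cup I_{n+1}\big]=(1-\beta)^{(n+2)(n+3)/2}\,\beta^{\sum_{(a,b,k)\in I_{n+1}}p^k_{(a,b)}-\sum_{(a,b,k)\in I_n}p^k_{(a,b)}}.\]
   Context: For $u\preceq v$ (coordinatewise), $\hat L^k_{u,v}$ is the maximum of $\sum_{i=1}^k\sum_{z\in\gamma_i}\hat\xi_z$ over (possibly empty) mutually disjoint up-right lattice paths $\gamma_1,\dots,\gamma_k$ contained in $\{z:u\preceq z\preceq v\}$; $\hat L^0=0$, $\hat W^k_{u,v}=\hat L^k_{u,v}-\hat L^{k-1}_{u,v}$, $\hat W^k_v=\hat W^k_{(0,0),v}$. $I_m=\{(a,b,k):a,b\in\mathbb{Z}_{\ge0},a+b=m,k\in\{1,\dots,1+\min(a,b)\}\}$. $\mathscr{I}\subset\mathbb{Z}_{\ge0}^{I_n\cup I_{n+1}}$ is the set of arrays $\{p^k_{(a,b)}\}$ satisfying $p^k_{(a,b)}\le p^k_{(a+1,b)}$, $p^k_{(a,b)}\ge p^{k+1}_{(a+1,b)}$ whenever $(a,b,k),(a+1,b,k)\in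 I_n\cup I_{n+1}$, and $p^k_{(a,b)}\le p^k_{(a,b+1)}$, $p^k_{(a,b)}\ge p^{k+1}_{(a,b+1)}$ whenever $(a,b,k),(a,b+1,k)\in I_n\cup I_{n+1}$. *)

theory Defs
  imports "HOL-Probability.Probability"
begin

fun up_right :: "(int \<times> int) list \<Rightarrow> bool" where
  "up_right [] = True"
| "up_right [z] = True"
| "up_right (z # z' # zs) =
     ((z' = (fst z + 1, snd z) \<or> z' = (fst z, snd z + 1)) \<and> up_right (z' # zs))"

definition rect :: "int \<times> int \<Rightarrow> int \<times> int \<Rightarrow> (int \<times> int) set" where
  "rect u v = {z. fst u \<le> fst z \<and> fst z \<le> fst v \<and> snd u \<le> snd z \<and> snd z \<le> snd v}"

definition LPP :: "(int \<times> int \<Rightarrow> nat) \<Rightarrow> nat \<Rightarrow> int \<times> int \<Rightarrow> int \<times> int \<Rightarrow> nat" where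
  "LPP w k u v = Max {(\<Sum>i<k. \<Sum>z\<in>set (\<gamma> i). w z) | \<gamma>.
      (\<forall>i<k. up_right (\<gamma> i) \<and> set (\<gamma> i) \<subseteq> rect u v) \<and>
      (\<forall>i<k. \<forall>j<k. i \<noteq> j \<longrightarrow> set (\<gamma> i) \<inter> set (\<gamma> j) = {})}"

definition Wk :: "(int \<times> int \<Rightarrow> nat) \<Rightarrow> nat \<Rightarrow> int \<times> int \<Rightarrow> int" where
  "Wk w k v = int (LPP w k (0,0) v) - int (LPP w (k - 1) (0,0) v)"

definition Iset :: "nat \<Rightarrow> (nat \<times> nat \<times> nat) set" where
  "Iset m = {(a, b, k). a + b = m \<and> 1 \<le> k \<and> k \<le> 1 + min a b}"

text \<open>The interlacing set script-I for arrays p indexed by I_n \<union> I_{n+1}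
  (an array is a function p a b k; only its values on the index set matter).
  Each inequality is imposed whenever all array entries it mentions are indexed
  by I_n \<union> I_{n+1}.\<close>
definition in_scriptI :: "nat \<Rightarrow> (nat \<Rightarrow> nat \<Rightarrow> nat \<Rightarrow> nat) \<Rightarrow> bool" where
  "in_scriptI n p \<longleftrightarrow>
     (let J = Iset n \<union> Iset (Suc n) in
      (\<forall>a b k. (a, b, k) \<in> J \<and> (Suc a, b, k) \<in> J \<longrightarrow> p a b k \<le> p (Suc a) b k) \<and>
      (\<forall>a b k. (a, b, k) \<in> J \<and> (Suc a, b, k) \<in> J \<and> (Suc a, b, Suc k) \<in> J
               \<longrightarrow> p a b k \<ge> p (Suc a) b (Suc k)) \<and>
      (\<forall>a b k. (a, b, k) \<in> J \<and> (a, Suc b, k) \<in> J \<longrightarrow> p a b k \<le> p a (Suc b) k) \<and>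
      (\<forall>a b k. (a, b, k) \<in> J \<and> (a, Suc b, k) \<in> J \<and> (a, Suc b, Suc k) \<in> J
               \<longrightarrow> p a b k \<ge> p a (Suc b) (Suc k)))"

end

theory Submission
  imports Defs
begin

text \<open>The map from the weights on the triangle $a+b\le n+1$ to the arrays $W^k_{(a,b)}$ is a bijection
  onto the interlacing arrays (a form of the Robinson--Schensted--Knuth correspondence) under which
  the total weight becomes the exponent of $\beta$; so the event fixes all weights of the triangle.
  The bijection is generated by the local growth rule
  $W^{k+1}_{(a+1,b+1)} + W^{k}_{(a,b)} = \max(W^{k+1}_{(a,b+1)}, W^{k+1}_{(a+1,b)}) +
  \min(W^{k}_{(a,b+1)}, W^{k}_{(a+1,b)})$ for $k\ge1$, which can be solved for either corner.
  It holds because passing the weights of two adjacent rows through a queue preserves the maximal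
  weight of $k$ disjoint paths; repeating this sorts the environment into interlacing lines, where
  optimal paths collect exactly the top $k$ lines.\<close>

text \<open>The local rule and the global maxima meet only in the exchange of two adjacent rows:
  with the heights above and below the pair fixed, just the height function between them changes, so
  a comparison inside two rows becomes one for whole families of paths. The exponent of
  \<open>\<beta>\<close> has a geometric reason. The lines at (a, b) add up to the total weight of
  the rectangle with that corner. A cell on antidiagonal m lies in n+2-m of the rectangles with
  corner on antidiagonal n+1 and in n+1-m of those with corner on antidiagonal n, so the difference
  of the two sums counts each cell of the triangle once. The proof obtains this by induction, as a
  second difference over antidiagonals. The exponent of \<open>1 - \<beta>\<close> is the number of
  cells, (n+2)(n+3)/2; the padding of the indices moves the levels n, n+1 to n+2, n+3.\<close>

section \<open>The growth rule\<close>

text \<open>Indices are padded: for \<open>w a b\<close> the weight of the cell \<open>(a, b)\<close>, the value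
  \<open>lam w (Suc a) (Suc b) i\<close> will turn out to be $W^{i+1}_{(a,b)}$, and the shapes with \<open>a = 0\<close>
  or \<open>b = 0\<close> are empty.\<close>

fun lam :: "(nat \<Rightarrow> nat \<Rightarrow> int) \<Rightarrow> nat \<Rightarrow> nat \<Rightarrow> nat \<Rightarrow> int" where
  "lam w 0 b i = 0"
| "lam w (Suc a) 0 i = 0"
| "lam w (Suc a) (Suc b) 0 = max (lam w a (Suc b) 0) (lam w (Suc a) b 0) + w a b"
| "lam w (Suc a) (Suc b) (Suc i) = max (lam w a (Suc b) (Suc i)) (lam w (Suc a) b (Suc i))
     + min (lam w a (Suc b) i) (lam w (Suc a) b i) - lam w a b i"

text \<open>In terms of the tropical row insertion of row \<open>b\<close>, the amount that reaches line \<open>i\<close> in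
  column \<open>a\<close> after having been bumped out of line \<open>i - 1\<close>.\<close>

definition bump :: "(nat \<Rightarrow> nat \<Rightarrow> int) \<Rightarrow> nat \<Rightarrow> nat \<Rightarrow> nat \<Rightarrow> int" where
  "bump w a b i = (case i of 0 \<Rightarrow> w a b
     | Suc j \<Rightarrow> min (lam w a (Suc b) j) (lam w (Suc a) b j) - lam w a b j)"

lemma lam_Suc_Suc:
  "lam w (Suc a) (Suc b) i = max (lam w a (Suc b) i) (lam w (Suc a) b i) + bump w a b i"
  by (cases i) (auto simp: bump_def)

lemma lam_0_right [simp]: "lam w a 0 i = 0"
  by (cases a) auto

locale nonneg_weights =
  fixes w :: "nat \<Rightarrow> nat \<Rightarrow> int"
  assumes w_nonneg: "0 \<le> w a b"
begin

text \<open>The inequalities support each other, hence one induction. The lines \<open>Suc i\<close>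
  of the two neighbours are at most line \<open>i\<close> of the lower left corner, so the growth
  rule puts line \<open>Suc i\<close> of the upper right corner below the smaller of the neighbours'
  lines \<open>i\<close>.\<close>

lemma lam_interlacing:
  "0 \<le> lam w a b i \<and> lam w a b i \<le> lam w (Suc a) b i \<and> lam w a b i \<le> lam w a (Suc b) i
   \<and> lam w (Suc a) b (Suc i) \<le> lam w a b i \<and> lam w a (Suc b) (Suc i) \<le> lam w a b i"
proof (induction "a + b" arbitrary: a b i rule: less_induct)
  case less
  have nn: "0 \<le> lam w a b i" for i
  proof (cases a)
    case (Suc a')
    then have "lam w a' b i \<ge> 0 \<and> lam w a' b i \<le> lam w a b i" using less[of a' b i] by auto
    then show ?thesis by linarith
  qed simp
  have r: "lam w a b i \<le> lam w (Suc a) b i \<and> lam w (Suc a) b (Suc i) \<le> lam w a b i" for i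
  proof (cases b)
    case (Suc b')
    have A: "lam w a b' j \<le> lam w (Suc a) b' j" "lam w a b' j \<le> lam w a b j"
       "lam w (Suc a) b' (Suc j) \<le> lam w a b' j" "lam w a b (Suc j) \<le> lam w a b' j" for j
      using less[of a b' j] Suc by auto
    have "0 \<le> bump w a b' i"
      using A[of "i - 1"] w_nonneg by (auto simp: bump_def Suc split: nat.split)
    moreover have "bump w a b' (Suc i) = min (lam w a b i) (lam w (Suc a) b' i) - lam w a b' i"
      by (simp add: bump_def Suc)
    ultimately show ?thesis using A[of i] by (auto simp: Suc lam_Suc_Suc)
  qed (auto simp: nn)
  have l: "lam w a b i \<le> lam w a (Suc b) i \<and> lam w a (Suc b) (Suc i) \<le> lam w a b i" for i
  proof (cases a)
    case (Suc a')
    have A: "lam w a' b j \<le> lam w a b j" "lam w a' b j \<le> lam w a' (Suc b) j"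
       "lam w a b (Suc j) \<le> lam w a' b j" "lam w a' (Suc b) (Suc j) \<le> lam w a' b j" for j
      using less[of a' b j] Suc by auto
    have "0 \<le> bump w a' b i"
      using A[of "i - 1"] w_nonneg by (auto simp: bump_def Suc split: nat.split)
    moreover have "bump w a' b (Suc i) = min (lam w a' (Suc b) i) (lam w a b i) - lam w a' b i"
      by (simp add: bump_def Suc)
    ultimately show ?thesis using A[of i] by (auto simp: Suc lam_Suc_Suc)
  qed (auto simp: nn)
  show ?case using nn[of i] r[of i] l[of i] by blast
qed

lemma lam_nonneg: "0 \<le> lam w a b i"
  and lam_mono_col: "lam w a b i \<le> lam w (Suc a) b i"
  and lam_mono_row: "lam w a b i \<le> lam w a (Suc b) i"
  and lam_interlace_col: "lam w (Suc a) b (Suc i) \<le> lam w a b i"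
  and lam_interlace_row: "lam w a (Suc b) (Suc i) \<le> lam w a b i"
  using lam_interlacing by auto

text \<open>Shortening the shorter side of the rectangle removes one line, by interlacing.\<close>

lemma lam_eq_0: "min a b \<le> i \<Longrightarrow> lam w a b i = 0"
proof (induction i arbitrary: a b)
  case 0
  then have "a = 0 \<or> b = 0" by (simp add: min_def split: if_splits)
  then show ?case by auto
next
  case (Suc i)
  show ?case
  proof (cases "a = 0 \<or> b = 0")
    case False
    then obtain a' b' where ab: "a = Suc a'" "b = Suc b'" by (auto simp: gr0_conv_Suc)
    then have "lam w a' b i = 0 \<or> lam w a b' i = 0"
      using Suc by (auto simp: min_def split: if_splits)
    then show ?thesis
      using lam_interlace_col[of a' b i] lam_interlace_row[of a b' i] lam_nonneg[of a b "Suc i"]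
        ab by auto
  qed auto
qed

lemma lam_decreasing: "lam w a b (Suc i) \<le> lam w a b i"
  using lam_interlace_col[of a b i] lam_mono_col[of a b "Suc i"] by linarith

end

section \<open>Exchanging two adjacent rows\<close>

text \<open>Families of disjoint paths are encoded by height functions. Rows are counted from the top, and
  \<open>f\<close>, \<open>g\<close> are the heights along the upper and the lower boundary of a row: the cell in column \<open>c\<close>
  is used iff \<open>g (Suc c) = f c + 1\<close>, and the \<open>t\<close>-th path is the boundary of the set of
  points of height at least \<open>t\<close>.\<close>

definition link :: "nat \<Rightarrow> (nat \<Rightarrow> int) \<Rightarrow> (nat \<Rightarrow> int) \<Rightarrow> bool" where
  "link A f g \<longleftrightarrow> f 0 = 0 \<and> g 0 = 0 \<and> (\<forall>c\<le>A. f c \<le> g c) \<and>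
     (\<forall>c<A. f c \<le> f (Suc c) \<and> g c \<le> g (Suc c) \<and> g (Suc c) \<le> f c + 1)"

definition row_weight :: "nat \<Rightarrow> (nat \<Rightarrow> int) \<Rightarrow> (nat \<Rightarrow> int) \<Rightarrow> (nat \<Rightarrow> int) \<Rightarrow> int" where
  "row_weight A x f g = (\<Sum>c<A. x c * (g (Suc c) - f c))"

lemma link_Suc:
  "link (Suc A) f g \<longleftrightarrow> link A f g \<and> f (Suc A) \<le> g (Suc A) \<and> f A \<le> f (Suc A) \<and>
     g A \<le> g (Suc A) \<and> g (Suc A) \<le> f A + 1"
  unfolding link_def by (auto simp: le_Suc_eq less_Suc_eq)

lemma link_cong:
  assumes "\<And>c. c \<le> A \<Longrightarrow> f c = f' c" "\<And>c. c \<le> A \<Longrightarrow> g c = g' c"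
  shows "link A f g = link A f' g'"
  using assms unfolding link_def by (auto simp: Suc_le_eq)

lemma row_weight_cong:
  assumes "\<And>c. c \<le> A \<Longrightarrow> f c = f' c" "\<And>c. c \<le> A \<Longrightarrow> g c = g' c"
    "\<And>c. c < A \<Longrightarrow> x c = x' c"
  shows "row_weight A x f g = row_weight A x' f' g'"
  unfolding row_weight_def using assms by (intro sum.cong) (auto simp: Suc_le_eq)

lemma row_weight_Suc:
  "row_weight (Suc A) x f g = row_weight A x f g + x A * (g (Suc A) - f A)"
  by (simp add: row_weight_def)

lemma link_upd1: "link A (f(Suc A := r)) g = link A f g"
  by (rule link_cong) auto
lemma link_upd2: "link A f (g(Suc A := r)) = link A f g"
  by (rule link_cong) auto
lemma row_weight_upd1: "row_weight A x (f(Suc A := r)) g = row_weight A x f g"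
  by (rule row_weight_cong) auto
lemma row_weight_upd2: "row_weight A x f (g(Suc A := r)) = row_weight A x f g"
  by (rule row_weight_cong) auto
lemmas upd_simps = link_upd1 link_upd2 row_weight_upd1 row_weight_upd2 link_Suc row_weight_Suc

lemma link_at:
  assumes "link A f g" shows "f A \<le> g A" using assms by (auto simp: link_def)

text \<open>A discrete queue: \<open>y\<close> are the arrivals, \<open>x\<close> the offered services, \<open>x'\<close> the departures
  and \<open>y'\<close> the arrivals plus the unused services; \<open>q c\<close> is the queue length before time \<open>c\<close>.\<close>

locale queue =
  fixes x y x' y' q :: "nat \<Rightarrow> int"
  assumes x': "\<And>c. x' c = min (q c) (x c)"
    and y': "\<And>c. y' c = x c + y c - x' c"
    and q_Suc: "\<And>c. q (Suc c) = y c + max (q c - x c) 0"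
    and q_nonneg: "\<And>c. 0 \<le> q c"
begin

text \<open>Given the heights \<open>Q\<close> above and \<open>P\<close> below the two rows, at most one path inside the rows has a
  choice at any time, namely when to move from the lower to the upper row. The invariant compares
  the two possible states of this path: where the new weights are worse in the lower row, their best
  value in the upper row exceeds the old value in the lower row by at least \<open>q A\<close>.\<close>

lemma swap_forward_aux:
  assumes "link A Q R" "link A R P"
  shows "(\<exists>R'. link A Q R' \<and> link A R' P \<and> R' A = R A \<and>
            row_weight A y Q R + row_weight A x R P \<le> row_weight A y' Q R' + row_weight A x' R' P)
     \<or> (R A = Q A \<and> P A = Q A + 1 \<and> (\<exists>R'. link A Q R' \<and> link A R' P \<and> R' A = P A \<and>
            row_weight A y Q R + row_weight A x R P + q A
              \<le> row_weight A y' Q R' + row_weight A x' R' P))"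
  using assms
proof (induction A)
  case 0
  then show ?case by (auto simp: row_weight_def)
next
  case (Suc A)
  note L = Suc.prems[unfolded link_Suc]
  define v where "v = row_weight A y Q R + row_weight A x R P"
  define V where "V R' = row_weight A y' Q R' + row_weight A x' R' P" for R'
  have QR: "Q A \<le> R A" and RP: "R A \<le> P A" using L link_at by auto
  have IH: "(\<exists>R'. link A Q R' \<and> link A R' P \<and> R' A = R A \<and> v \<le> V R')
     \<or> (R A = Q A \<and> P A = Q A + 1 \<and> (\<exists>R'. link A Q R' \<and> link A R' P \<and> R' A = P A \<and> v + q A \<le> V R'))"
    using Suc.IH L unfolding v_def V_def by blast
  \<comment> \<open>These indicate whether column \<open>A\<close> is used in the upper and in the
    lower row.\<close>
  define \<alpha> \<beta> where "\<alpha> = R (Suc A) - Q A" and "\<beta> = P (Suc A) - R A"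
  have \<alpha>: "\<alpha> = 0 \<or> \<alpha> = 1" and \<beta>: "\<beta> = 0 \<or> \<beta> = 1"
    using L QR RP unfolding \<alpha>_def \<beta>_def by linarith+
  have v1: "row_weight (Suc A) y Q R + row_weight (Suc A) x R P = v + y A * \<alpha> + x A * \<beta>"
    by (simp add: row_weight_Suc v_def \<alpha>_def \<beta>_def)
  have V1: "row_weight (Suc A) y' Q (R'(Suc A := r)) + row_weight (Suc A) x' (R'(Suc A := r)) P
     = V R' + y' A * (r - Q A) + x' A * (P (Suc A) - R' A)" for R' r
    by (simp add: row_weight_Suc row_weight_upd1 row_weight_upd2 V_def)
  have ext: "link (Suc A) Q (R'(Suc A := r)) \<and> link (Suc A) (R'(Suc A := r)) P"
    if "link A Q R'" "link A R' P" "Q (Suc A) \<le> r" "R' A \<le> r" "r \<le> Q A + 1" "r \<le> P (Suc A)"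
      "P (Suc A) \<le> R' A + 1" for R' r
    using that L by (auto simp: upd_simps)
  have qx: "x' A \<le> x A" "x' A \<le> q A" "x' A = x A \<or> (x' A = q A \<and> q A < x A)"
    using x' by auto
  from IH show ?case
  proof (elim disjE conjE exE)
    fix R' assume R': "link A Q R'" "link A R' P" "R' A = R A" "v \<le> V R'"
    show ?case
    proof (cases "\<alpha> = 0 \<and> \<beta> = 1 \<and> x' A = q A \<and> q A < x A")
      case False
      \<comment> \<open>Using the same cells changes the value by
        \<open>(x A - x' A) * (\<alpha> - \<beta>)\<close>, which is negative only in the excluded
        case.\<close>
      have "v + y A * \<alpha> + x A * \<beta> \<le> V R' + y' A * \<alpha> + x' A * \<beta>"
        using False \<alpha> \<beta> R'(4) qx y'[of A] by auto
      then have "row_weight (Suc A) y Q R + row_weight (Suc A) x R P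
        \<le> row_weight (Suc A) y' Q (R'(Suc A := R (Suc A)))
          + row_weight (Suc A) x' (R'(Suc A := R (Suc A))) P"
        unfolding v1 V1 using R'(3) by (simp add: \<alpha>_def \<beta>_def)
      moreover have "link (Suc A) Q (R'(Suc A := R (Suc A))) \<and> link (Suc A) (R'(Suc A := R (Suc A))) P"
        using L R' by (intro ext) auto
      ultimately show ?thesis
        by (intro disjI1 exI[of _ "R'(Suc A := R (Suc A))"]) (auto simp del: fun_upd_apply simp add: fun_upd_same)
    next
      case True
      \<comment> \<open>Service exceeds the queue, so \<open>q (Suc A) = y A\<close>. The new path
        takes both cells of column \<open>A\<close> instead of the lower one; as
        \<open>x' A + y' A = x A + y A\<close>, its surplus is exactly
        \<open>q (Suc A)\<close>.\<close>
      have e: "R (Suc A) = Q A" "Q (Suc A) = Q A" "R A = Q A" "P (Suc A) = Q A + 1"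
        using True L QR unfolding \<alpha>_def \<beta>_def by auto
      have "link (Suc A) Q (R'(Suc A := P (Suc A))) \<and> link (Suc A) (R'(Suc A := P (Suc A))) P"
        using L R' e by (intro ext) auto
      moreover have "row_weight (Suc A) y Q R + row_weight (Suc A) x R P + q (Suc A)
        \<le> row_weight (Suc A) y' Q (R'(Suc A := P (Suc A)))
          + row_weight (Suc A) x' (R'(Suc A := P (Suc A))) P"
        unfolding v1 V1 using R' True e y'[of A] q_Suc[of A] by simp
      ultimately show ?thesis
        using e by (intro disjI2 conjI exI[of _ "R'(Suc A := P (Suc A))"]) (auto simp del: fun_upd_apply simp add: fun_upd_same)
    qed
  next
    fix R' assume R': "R A = Q A" "P A = Q A + 1" "link A Q R'" "link A R' P" "R' A = P A"
      "v + q A \<le> V R'"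
    have e: "P (Suc A) = Q A + 1" using L R' by auto
    have lk: "link (Suc A) Q (R'(Suc A := P (Suc A))) \<and> link (Suc A) (R'(Suc A := P (Suc A))) P"
      using L R' e by (intro ext) auto
    have V2: "row_weight (Suc A) y' Q (R'(Suc A := P (Suc A)))
          + row_weight (Suc A) x' (R'(Suc A := P (Suc A))) P = V R' + y' A"
      unfolding V1 using R' e by simp
    show ?case
    proof (cases "\<alpha> = 1")
      case True
      then have "R (Suc A) = P (Suc A)" using e R' by (auto simp: \<alpha>_def)
      moreover have "row_weight (Suc A) y Q R + row_weight (Suc A) x R P \<le> V R' + y' A"
        unfolding v1 using True R' e y'[of A] qx by (simp add: \<beta>_def)
      ultimately show ?thesis using lk V2
        by (intro disjI1 conjI exI[of _ "R'(Suc A := P (Suc A))"]) (auto simp del: fun_upd_apply simp add: fun_upd_same)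
    next
      case False
      then have "R (Suc A) = Q A" using \<alpha> by (auto simp: \<alpha>_def)
      moreover from this have "Q (Suc A) = Q A" using L by auto
      moreover have "row_weight (Suc A) y Q R + row_weight (Suc A) x R P + q (Suc A) \<le> V R' + y' A"
        unfolding v1 using False \<alpha> R' e y'[of A] qx q_Suc[of A] by (auto simp: \<beta>_def)
      ultimately show ?thesis using lk V2 e
        by (intro disjI2 conjI exI[of _ "R'(Suc A := P (Suc A))"]) (auto simp del: fun_upd_apply simp add: fun_upd_same)
    qed
  qed
qed

lemma swap_backward_aux:
  assumes "link A Q R'" "link A R' P"
  shows "(\<exists>R. link A Q R \<and> link A R P \<and> R A = R' A \<and>
            row_weight A y' Q R' + row_weight A x' R' P \<le> row_weight A y Q R + row_weight A x R P)
     \<and> (R' A = P A \<and> P A = Q A + 1 \<longrightarrow> (\<exists>R. link A Q R \<and> link A R P \<and> R A = Q A \<and>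
            row_weight A y' Q R' + row_weight A x' R' P
              \<le> row_weight A y Q R + row_weight A x R P + q A))"
  using assms
proof (induction A)
  case 0
  then show ?case by (auto simp: row_weight_def link_def)
next
  case (Suc A)
  note L = Suc.prems[unfolded link_Suc]
  define v where "v = row_weight A y' Q R' + row_weight A x' R' P"
  define V where "V R = row_weight A y Q R + row_weight A x R P" for R
  have QR: "Q A \<le> R' A" and RP: "R' A \<le> P A" using L link_at by auto
  have IH1: "\<exists>R. link A Q R \<and> link A R P \<and> R A = R' A \<and> v \<le> V R"
    and IH2: "R' A = P A \<Longrightarrow> P A = Q A + 1 \<Longrightarrow>
       \<exists>R. link A Q R \<and> link A R P \<and> R A = Q A \<and> v \<le> V R + q A"
    using Suc.IH L unfolding v_def V_def by blast+
  define \<alpha> \<beta> where "\<alpha> = R' (Suc A) - Q A" and "\<beta> = P (Suc A) - R' A"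
  have \<alpha>: "\<alpha> = 0 \<or> \<alpha> = 1" and \<beta>: "\<beta> = 0 \<or> \<beta> = 1"
    using L QR RP unfolding \<alpha>_def \<beta>_def by linarith+
  have v1: "row_weight (Suc A) y' Q R' + row_weight (Suc A) x' R' P = v + y' A * \<alpha> + x' A * \<beta>"
    by (simp add: row_weight_Suc v_def \<alpha>_def \<beta>_def)
  have V1: "row_weight (Suc A) y Q (R(Suc A := r)) + row_weight (Suc A) x (R(Suc A := r)) P
     = V R + y A * (r - Q A) + x A * (P (Suc A) - R A)" for R r
    by (simp add: row_weight_Suc row_weight_upd1 row_weight_upd2 V_def)
  have ext: "link (Suc A) Q (R(Suc A := r)) \<and> link (Suc A) (R(Suc A := r)) P"
    if "link A Q R" "link A R P" "Q (Suc A) \<le> r" "R A \<le> r" "r \<le> Q A + 1" "r \<le> P (Suc A)"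
      "P (Suc A) \<le> R A + 1" for R r
    using that L by (auto simp: upd_simps)
  have qx: "x' A \<le> x A" "x' A \<le> q A" "x' A = x A \<or> (x' A = q A \<and> q A < x A)"
    using x' by auto
  have 1: "\<exists>R. link (Suc A) Q R \<and> link (Suc A) R P \<and> R (Suc A) = R' (Suc A) \<and>
            v + y' A * \<alpha> + x' A * \<beta> \<le> row_weight (Suc A) y Q R + row_weight (Suc A) x R P"
  proof (cases "\<alpha> = 1 \<and> \<beta> = 0 \<and> x' A = q A \<and> q A < x A")
    case False
    obtain R where R: "link A Q R" "link A R P" "R A = R' A" "v \<le> V R" using IH1 by blast
    have "v + y' A * \<alpha> + x' A * \<beta> \<le> V R + y A * \<alpha> + x A * \<beta>"
      using False \<alpha> \<beta> R(4) qx y'[of A] by auto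
    then have "v + y' A * \<alpha> + x' A * \<beta> \<le> row_weight (Suc A) y Q (R(Suc A := R' (Suc A)))
        + row_weight (Suc A) x (R(Suc A := R' (Suc A))) P"
      unfolding V1 using R(3) by (simp add: \<alpha>_def \<beta>_def)
    moreover have "link (Suc A) Q (R(Suc A := R' (Suc A))) \<and> link (Suc A) (R(Suc A := R' (Suc A))) P"
      using L R by (intro ext) auto
    ultimately show ?thesis by (intro exI[of _ "R(Suc A := R' (Suc A))"]) (auto simp del: fun_upd_apply simp add: fun_upd_same)
  next
    case True
    \<comment> \<open>The path that stayed low takes both cells of column \<open>A\<close> and
      collects \<open>x A + y A = y' A + q A\<close>, which cancels its deficit.\<close>
    have PA: "P A \<le> P (Suc A)" using L by auto
    have e: "R' (Suc A) = Q A + 1" "P (Suc A) = Q A + 1" "R' A = Q A + 1" "P A = Q A + 1"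
      using True L QR RP PA unfolding \<alpha>_def \<beta>_def by linarith+
    obtain R where R: "link A Q R" "link A R P" "R A = Q A" "v \<le> V R + q A"
      using IH2 e by auto
    have "link (Suc A) Q (R(Suc A := R' (Suc A))) \<and> link (Suc A) (R(Suc A := R' (Suc A))) P"
      using L R e by (intro ext) auto
    moreover have "v + y' A * \<alpha> + x' A * \<beta> \<le> row_weight (Suc A) y Q (R(Suc A := R' (Suc A)))
        + row_weight (Suc A) x (R(Suc A := R' (Suc A))) P"
      unfolding V1 using R True e y'[of A] by simp
    ultimately show ?thesis by (intro exI[of _ "R(Suc A := R' (Suc A))"]) (auto simp del: fun_upd_apply simp add: fun_upd_same)
  qed
  have 2: "\<exists>R. link (Suc A) Q R \<and> link (Suc A) R P \<and> R (Suc A) = Q (Suc A) \<and>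
            v + y' A * \<alpha> + x' A * \<beta>
              \<le> row_weight (Suc A) y Q R + row_weight (Suc A) x R P + q (Suc A)"
    if U: "R' (Suc A) = P (Suc A)" "P (Suc A) = Q (Suc A) + 1"
  proof -
    have e: "Q (Suc A) = Q A" "R' (Suc A) = Q A + 1" "P (Suc A) = Q A + 1" "\<alpha> = 1"
      using L U unfolding \<alpha>_def by linarith+
    have lk: "link (Suc A) Q (R(Suc A := Q A)) \<and> link (Suc A) (R(Suc A := Q A)) P"
      if "link A Q R" "link A R P" "R A = Q A" for R
      using L that e by (intro ext) auto
    show ?thesis
    proof (cases "\<beta> = 1")
      case True
      then have "R' A = Q A" using e by (auto simp: \<beta>_def)
      then obtain R where R: "link A Q R" "link A R P" "R A = Q A" "v \<le> V R" using IH1 by auto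
      have "v + y' A * \<alpha> + x' A * \<beta> \<le> row_weight (Suc A) y Q (R(Suc A := Q A))
        + row_weight (Suc A) x (R(Suc A := Q A)) P + q (Suc A)"
        unfolding V1 using R True e y'[of A] q_Suc[of A] by simp
      then show ?thesis using lk[OF R(1-3)] e by (intro exI[of _ "R(Suc A := Q A)"]) (auto simp del: fun_upd_apply simp add: fun_upd_same)
    next
      case False
      then have b: "\<beta> = 0" using \<beta> by auto
      have "R' A = P A" "P A = Q A + 1" using b e L RP unfolding \<beta>_def by linarith+
      then obtain R where R: "link A Q R" "link A R P" "R A = Q A" "v \<le> V R + q A"
        using IH2 by auto
      have "v + y' A * \<alpha> + x' A * \<beta> \<le> row_weight (Suc A) y Q (R(Suc A := Q A))
        + row_weight (Suc A) x (R(Suc A := Q A)) P + q (Suc A)"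
        unfolding V1 using R b e y'[of A] q_Suc[of A] qx by auto
      then show ?thesis using lk[OF R(1-3)] e by (intro exI[of _ "R(Suc A := Q A)"]) (auto simp del: fun_upd_apply simp add: fun_upd_same)
    qed
  qed
  show ?case unfolding v1 using 1 2 by blast
qed

lemma swap_forward:
  assumes "link A Q R" "link A R P"
  shows "\<exists>R'. link A Q R' \<and> link A R' P \<and>
            row_weight A y Q R + row_weight A x R P \<le> row_weight A y' Q R' + row_weight A x' R' P"
  using swap_forward_aux[OF assms] q_nonneg[of A] by fastforce

lemma swap_backward:
  assumes "link A Q R'" "link A R' P"
  shows "\<exists>R. link A Q R \<and> link A R P \<and>
            row_weight A y' Q R' + row_weight A x' R' P \<le> row_weight A y Q R + row_weight A x R P"
  using swap_backward_aux[OF assms] by blast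

end

section \<open>Reduction to interlacing lines\<close>

definition heights :: "nat \<Rightarrow> nat \<Rightarrow> nat \<Rightarrow> (nat \<Rightarrow> nat \<Rightarrow> int) \<Rightarrow> bool" where
  "heights A B k H \<longleftrightarrow>
     (\<forall>c. H 0 c = 0) \<and> (\<forall>i<B. link A (H i) (H (Suc i))) \<and> H B A \<le> int k"

definition weight :: "nat \<Rightarrow> nat \<Rightarrow> (nat \<Rightarrow> nat \<Rightarrow> int) \<Rightarrow> (nat \<Rightarrow> nat \<Rightarrow> int) \<Rightarrow> int" where
  "weight A B u H = (\<Sum>i<B. row_weight A (u i) (H i) (H (Suc i)))"

text \<open>Compares the optimal values for all numbers of paths at once, phrased without maxima so
  that their existence need not be shown.\<close>

definition dominated :: "nat \<Rightarrow> nat \<Rightarrow> (nat \<Rightarrow> nat \<Rightarrow> int) \<Rightarrow> (nat \<Rightarrow> nat \<Rightarrow> int) \<Rightarrow> bool" where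
  "dominated A B u u' \<longleftrightarrow>
     (\<forall>k H. heights A B k H \<longrightarrow> (\<exists>H'. heights A B k H' \<and> weight A B u H \<le> weight A B u' H'))"

lemma dominated_trans: "dominated A B u v \<Longrightarrow> dominated A B v z \<Longrightarrow> dominated A B u z"
  unfolding dominated_def by (meson order_trans)

lemma weight_cong:
  assumes "\<And>i c. i < B \<Longrightarrow> c < A \<Longrightarrow> u i c = u' i c"
  shows "weight A B u H = weight A B u' H"
  unfolding weight_def using assms by (intro sum.cong row_weight_cong) auto

lemma dominated_refl:
  assumes "\<And>i c. i < B \<Longrightarrow> c < A \<Longrightarrow> u i c = u' i c"
  shows "dominated A B u u'"
  unfolding dominated_def using weight_cong[of B A u u'] assms by fastforce

lemma sum_split_two:
  fixes f :: "nat \<Rightarrow> int"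
  assumes "Suc j < B"
  shows "(\<Sum>i<B. f i) = f j + f (Suc j) + (\<Sum>i\<in>{..<B} - {j, Suc j}. f i)"
proof -
  have "{..<B} = insert j (insert (Suc j) ({..<B} - {j, Suc j}))" using assms by auto
  then have "(\<Sum>i<B. f i) = sum f (insert j (insert (Suc j) ({..<B} - {j, Suc j})))" by simp
  then show ?thesis by simp
qed

text \<open>Localises the exchange: the rows \<open>j\<close> and \<open>Suc j\<close> share only
  the height function \<open>H (Suc j)\<close>, so replacing it leaves every other row as it
  was.\<close>

lemma replace_row:
  assumes H: "heights A B k H" and j: "Suc j < B"
    and R: "link A (H j) R" "link A R (H (Suc (Suc j)))"
    and w: "row_weight A (u j) (H j) (H (Suc j)) + row_weight A (u (Suc j)) (H (Suc j)) (H (Suc (Suc j)))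
      \<le> row_weight A (u' j) (H j) R + row_weight A (u' (Suc j)) R (H (Suc (Suc j)))"
    and eq: "\<And>i. i < B \<Longrightarrow> i \<noteq> j \<Longrightarrow> i \<noteq> Suc j \<Longrightarrow> u i = u' i"
  shows "heights A B k (H(Suc j := R)) \<and> weight A B u H \<le> weight A B u' (H(Suc j := R))"
proof
  show "heights A B k (H(Suc j := R))"
    using H j R unfolding heights_def by (auto simp: less_Suc_eq)
  have "(\<Sum>i\<in>{..<B} - {j, Suc j}. row_weight A (u i) (H i) (H (Suc i)))
     = (\<Sum>i\<in>{..<B} - {j, Suc j}. row_weight A (u' i) ((H(Suc j := R)) i) ((H(Suc j := R)) (Suc i)))"
    using eq by (intro sum.cong) auto
  then show "weight A B u H \<le> weight A B u' (H(Suc j := R))"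
    unfolding weight_def sum_split_two[OF j] using w by simp
qed

lemma (in queue) dominated_swap:
  assumes j: "Suc j < B" and u: "u j = y" "u (Suc j) = x" and u': "u' j = y'" "u' (Suc j) = x'"
    and eq: "\<And>i. i < B \<Longrightarrow> i \<noteq> j \<Longrightarrow> i \<noteq> Suc j \<Longrightarrow> u i = u' i"
  shows "dominated A B u u' \<and> dominated A B u' u"
  unfolding dominated_def
proof (intro conjI allI impI)
  fix k H assume H: "heights A B k H"
  then have l: "link A (H j) (H (Suc j))" "link A (H (Suc j)) (H (Suc (Suc j)))"
    using j by (auto simp: heights_def)
  obtain R where "link A (H j) R" "link A R (H (Suc (Suc j)))"
    "row_weight A (u j) (H j) (H (Suc j)) + row_weight A (u (Suc j)) (H (Suc j)) (H (Suc (Suc j)))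
      \<le> row_weight A (u' j) (H j) R + row_weight A (u' (Suc j)) R (H (Suc (Suc j)))"
    using swap_forward[OF l] u u' by auto
  then show "\<exists>H'. heights A B k H' \<and> weight A B u H \<le> weight A B u' H'"
    using replace_row[where u = u and u' = u', OF H j] eq by blast
  obtain R where "link A (H j) R" "link A R (H (Suc (Suc j)))"
    "row_weight A (u' j) (H j) (H (Suc j)) + row_weight A (u' (Suc j)) (H (Suc j)) (H (Suc (Suc j)))
      \<le> row_weight A (u j) (H j) R + row_weight A (u (Suc j)) R (H (Suc (Suc j)))"
    using swap_backward[OF l] u u' by auto
  then show "\<exists>H'. heights A B k H' \<and> weight A B u' H \<le> weight A B u H'"
    using replace_row[where u = u' and u' = u, OF H j] eq by metis
qed

text \<open>The environment while row \<open>b\<close> is inserted: its first \<open>s\<close> rows are still untouched, the lines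
  \<open>0, \<dots>, j - 1\<close> of the rows \<open>0, \<dots>, b\<close> are ready, and below the bumped row sit the remaining lines of
  the rows \<open>0, \<dots>, b - 1\<close>.\<close>

definition env :: "(nat \<Rightarrow> nat \<Rightarrow> int) \<Rightarrow> nat \<Rightarrow> nat \<Rightarrow> nat \<Rightarrow> nat \<Rightarrow> nat \<Rightarrow> int" where
  "env w B b j i = (let s = B - Suc b in
     if i < s then (\<lambda>c. w c (B - 1 - i))
     else if i < s + j then (\<lambda>c. lam w (Suc c) (Suc b) (i - s) - lam w c (Suc b) (i - s))
     else if i = s + j then (\<lambda>c. bump w c b j)
     else (\<lambda>c. lam w (Suc c) b (i - s - 1) - lam w c b (i - s - 1)))"

text \<open>The fully sorted environment, given by the increments of the interlacing lines; such an
  ensemble of ordered lines is known as a melon.\<close>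

definition melon :: "(nat \<Rightarrow> nat \<Rightarrow> int) \<Rightarrow> nat \<Rightarrow> nat \<Rightarrow> nat \<Rightarrow> int" where
  "melon w B i c = lam w (Suc c) B i - lam w c B i"

context nonneg_weights
begin

text \<open>With only \<open>b\<close> rows line \<open>b\<close> is still empty, so what is bumped
  out of the last existing line becomes the new line unchanged.\<close>

lemma bump_last: "bump w c b b = melon w (Suc b) b c"
proof -
  have "lam w (Suc c) b b = 0" "0 \<le> lam w c (Suc b) b"
    using lam_eq_0 lam_nonneg by auto
  then show ?thesis using lam_Suc_Suc[of w c b b] by (simp add: melon_def)
qed

text \<open>Row insertion as a queue: the bumped row arrives, the increments of the old line
  \<open>j\<close> are the services, the departures are bumped into line \<open>Suc j\<close>, and
  the queue length is the gap between the new and the old line \<open>j\<close>.\<close>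

lemma queue_lam:
  "queue (\<lambda>c. lam w (Suc c) b j - lam w c b j) (\<lambda>c. bump w c b j)
     (\<lambda>c. bump w c b (Suc j)) (\<lambda>c. lam w (Suc c) (Suc b) j - lam w c (Suc b) j)
     (\<lambda>c. lam w c (Suc b) j - lam w c b j)"
  using lam_mono_row
  by unfold_locales (auto simp: lam_Suc_Suc bump_def[of w _ b "Suc j"] min_def max_def)

lemma env_step:
  assumes "b < B" "j < b"
  shows "dominated A B (env w B b j) (env w B b (Suc j)) \<and> dominated A B (env w B b (Suc j)) (env w B b j)"
  by (rule queue.dominated_swap[OF queue_lam, of "B - Suc b + j"])
     (use assms in \<open>auto simp: env_def Let_def\<close>)

lemma env_row:
  assumes "b < B" "j \<le> b"
  shows "dominated A B (env w B b 0) (env w B b j) \<and> dominated A B (env w B b j) (env w B b 0)"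
  using assms(2)
proof (induction j)
  case 0
  then show ?case using dominated_refl by blast
next
  case (Suc j)
  then show ?case using env_step[OF assms(1), of j A] dominated_trans by (meson Suc_leD Suc_le_lessD)
qed

lemma env_next_row:
  assumes "Suc b < B" "i < B"
  shows "env w B b b i c = env w B (Suc b) 0 i c"
proof -
  define s where "s = B - Suc (Suc b)"
  have s: "B - Suc b = Suc s" "B = s + Suc (Suc b)" using assms by (auto simp: s_def)
  consider "i < s" | "i = s" | "Suc s \<le> i" "i < Suc s + b" | "i = Suc s + b"
    using assms s by linarith
  then show ?thesis
  proof cases
    case 4
    then show ?thesis using bump_last[of c b] s by (simp add: env_def s_def[symmetric] melon_def)
  qed (use s in \<open>auto simp: env_def s_def[symmetric] bump_def\<close>)
qed

lemma env_all:
  assumes "b < B"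
  shows "dominated A B (env w B 0 0) (env w B b b) \<and> dominated A B (env w B b b) (env w B 0 0)"
  using assms
proof (induction b)
  case 0
  then show ?case using dominated_refl by blast
next
  case (Suc b)
  have "dominated A B (env w B b b) (env w B (Suc b) 0)" "dominated A B (env w B (Suc b) 0) (env w B b b)"
    using env_next_row Suc.prems by (auto intro!: dominated_refl)
  then show ?case using Suc env_row[of "Suc b" B "Suc b" A] dominated_trans
    by (meson Suc_lessD order_refl)
qed

lemma dominated_melon:
  assumes "0 < B"
  shows "dominated A B (\<lambda>i c. w c (B - 1 - i)) (melon w B)"
    and "dominated A B (melon w B) (\<lambda>i c. w c (B - 1 - i))"
proof -
  have 1: "env w B 0 0 i c = w c (B - 1 - i)" if "i < B" for i c
    using that assms by (auto simp: env_def Let_def bump_def)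
  have 2: "env w B (B - 1) (B - 1) i c = melon w B i c" if "i < B" for i c
  proof (cases "i = B - 1")
    case True
    then show ?thesis using bump_last[of c "B - 1"] assms by (auto simp: env_def Let_def)
  next
    case False
    then show ?thesis using that assms by (auto simp: env_def Let_def melon_def)
  qed
  have e: "dominated A B (env w B 0 0) (env w B (B - 1) (B - 1))"
    "dominated A B (env w B (B - 1) (B - 1)) (env w B 0 0)"
    using env_all[of "B - 1" B A] assms by auto
  have d: "dominated A B (env w B 0 0) (\<lambda>i c. w c (B - 1 - i))"
     "dominated A B (\<lambda>i c. w c (B - 1 - i)) (env w B 0 0)"
     "dominated A B (env w B (B - 1) (B - 1)) (melon w B)"
     "dominated A B (melon w B) (env w B (B - 1) (B - 1))"
    using 1 2 by (auto intro!: dominated_refl)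
  show "dominated A B (\<lambda>i c. w c (B - 1 - i)) (melon w B)"
    "dominated A B (melon w B) (\<lambda>i c. w c (B - 1 - i))"
    using e d by (blast intro: dominated_trans)+
qed

section \<open>Optimal families in interlacing lines\<close>

lemma sum_top_bound:
  fixes s \<delta> :: "nat \<Rightarrow> int"
  assumes nn: "\<And>i. 0 \<le> s i" and dec: "\<And>i. s (Suc i) \<le> s i"
    and \<delta>: "\<And>i. i < B \<Longrightarrow> 0 \<le> \<delta> i \<and> \<delta> i \<le> 1" and k: "(\<Sum>i<B. \<delta> i) \<le> int k"
  shows "(\<Sum>i<B. s i * \<delta> i) \<le> (\<Sum>i<k. s i)"
proof -
  have anti: "s j \<le> s i" if "i \<le> j" for i j using lift_Suc_antimono_le[of s, OF dec that] .
  show ?thesis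
  proof (cases "B \<le> k")
    case True
    have "(\<Sum>i<B. s i * \<delta> i) \<le> (\<Sum>i<B. s i)"
      using \<delta> nn by (intro sum_mono mult_left_le) auto
    also have "\<dots> \<le> (\<Sum>i<k. s i)" using True nn by (intro sum_mono2) auto
    finally show ?thesis .
  next
    case False
    \<comment> \<open>Subtracting the threshold \<open>s k\<close> makes all terms from index
      \<open>k\<close> on nonpositive; the subtracted mass is at most \<open>t * k\<close>.\<close>
    define t where "t = s k"
    have "(\<Sum>i<B. (s i - t) * \<delta> i) = (\<Sum>i<k. (s i - t) * \<delta> i) + (\<Sum>i\<in>{k..<B}. (s i - t) * \<delta> i)"
      using False sum.atLeastLessThan_concat[of 0 k B "\<lambda>i. (s i - t) * \<delta> i"]
      by (simp add: lessThan_atLeast0)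
    also have "\<dots> \<le> (\<Sum>i<k. s i - t) + 0"
      using False anti \<delta> unfolding t_def
      by (intro add_mono sum_mono mult_left_le sum_nonpos mult_nonpos_nonneg) auto
    also have "\<dots> = (\<Sum>i<k. s i) - t * int k" by (simp add: sum_subtractf)
    finally have "(\<Sum>i<B. s i * \<delta> i) - t * (\<Sum>i<B. \<delta> i) \<le> (\<Sum>i<k. s i) - t * int k"
      by (simp add: left_diff_distrib sum_subtractf sum_distrib_left)
    moreover have "t * (\<Sum>i<B. \<delta> i) \<le> t * int k" using k nn[of k] by (simp add: t_def mult_left_mono)
    ultimately show ?thesis by linarith
  qed
qed

lemma weight_Suc:
  "weight (Suc A) B u H = weight A B u H + (\<Sum>i<B. u i A * (H (Suc i) (Suc A) - H i A))"
  by (simp add: weight_def row_weight_Suc sum.distrib)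

lemma heights_restrict:
  assumes "heights (Suc A) B k H" shows "heights A B k H"
proof -
  have "H B A \<le> H B (Suc A)"
    using assms by (cases B) (auto simp: heights_def link_Suc)
  then show ?thesis using assms by (auto simp: heights_def link_Suc)
qed

text \<open>A path never holds more than the full value of the line on which it sits. When it steps
  up from line \<open>Suc i\<close> to line \<open>i\<close> in column \<open>A\<close>, it holds at
  most \<open>lam w (Suc A) B (Suc i)\<close>, and by interlacing this is at most what line
  \<open>i\<close> amounts to before that column.\<close>

lemma melon_weight_partial:
  assumes "heights A B k H"
  shows "weight A B (melon w B) H \<le> (\<Sum>i<B. lam w A B i * (H (Suc i) A - H i A))"
  using assms
proof (induction A)
  case 0
  then show ?case by (simp add: weight_def row_weight_def)
next
  case (Suc A)
  have L: "H i A \<le> H i (Suc A)" if "i \<le> B" for i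
    using Suc.prems that by (cases i) (auto simp: heights_def link_Suc)
  have H0: "H 0 c = 0" for c using Suc.prems by (auto simp: heights_def)
  have IH: "weight A B (melon w B) H \<le> (\<Sum>i<B. lam w A B i * (H (Suc i) A - H i A))"
    using Suc heights_restrict by blast
  define d where "d i = H i (Suc A) - H i A" for i
  have d: "0 \<le> d i" if "i \<le> B" for i using L that by (auto simp: d_def)
  have d0: "d 0 = 0" by (simp add: d_def H0)
  have "(\<Sum>i<B. lam w (Suc A) B i * d i) \<le> (\<Sum>i<B. lam w A B i * d (Suc i))"
  proof (cases B)
    case (Suc B')
    have "(\<Sum>i<B. lam w (Suc A) B i * d i) = (\<Sum>i<B'. lam w (Suc A) B (Suc i) * d (Suc i))"
      by (simp only: Suc sum.lessThan_Suc_shift d0)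
    also have "\<dots> \<le> (\<Sum>i<B'. lam w A B i * d (Suc i))"
      using d Suc by (intro sum_mono mult_right_mono lam_interlace_col) auto
    also have "\<dots> \<le> (\<Sum>i<B. lam w A B i * d (Suc i))"
      using lam_nonneg d Suc by simp
    finally show ?thesis .
  qed simp
  moreover have "(\<Sum>i<B. lam w A B i * (H (Suc i) A - H i A)) +
      (\<Sum>i<B. melon w B i A * (H (Suc i) (Suc A) - H i A))
    = (\<Sum>i<B. lam w (Suc A) B i * (H (Suc i) (Suc A) - H i (Suc A)))
      + (\<Sum>i<B. lam w (Suc A) B i * d i) - (\<Sum>i<B. lam w A B i * d (Suc i))"
    unfolding sum.distrib[symmetric] sum_subtractf[symmetric]
    by (intro sum.cong refl) (simp add: melon_def d_def algebra_simps)
  ultimately show ?case using IH unfolding weight_Suc by linarith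
qed

lemma melon_weight_le:
  assumes "heights A B k H"
  shows "weight A B (melon w B) H \<le> (\<Sum>i<k. lam w A B i)"
proof -
  have H0: "H 0 c = 0" for c using assms by (auto simp: heights_def)
  have "H (Suc i) A - H i A \<le> 1" if "i < B" for i
  proof (cases A)
    case 0
    then show ?thesis using assms that by (auto simp: heights_def link_def)
  next
    case (Suc A')
    then have "H (Suc i) A \<le> H i A' + 1" "H i A' \<le> H i A"
      using assms that by (auto simp: heights_def link_Suc)
    then show ?thesis by linarith
  qed
  moreover have "0 \<le> H (Suc i) A - H i A" if "i < B" for i
    using assms that by (auto simp: heights_def link_def)
  moreover have "(\<Sum>i<B. H (Suc i) A - H i A) = H B A"
    using sum_lessThan_telescope[of "\<lambda>i. H i A" B] by (simp add: H0)
  ultimately have "(\<Sum>i<B. lam w A B i * (H (Suc i) A - H i A)) \<le> (\<Sum>i<k. lam w A B i)"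
    using assms lam_nonneg lam_decreasing
    by (intro sum_top_bound) (auto simp: heights_def)
  then show ?thesis using melon_weight_partial[OF assms] by linarith
qed

lemma melon_weight_ge:
  "\<exists>H. heights A B k H \<and> (\<Sum>i<k. lam w A B i) \<le> weight A B (melon w B) H"
proof (intro exI conjI)
  \<comment> \<open>This family uses exactly the cells with \<open>i < k\<close> or
    \<open>c < k\<close>, in particular all of the top \<open>k\<close> lines.\<close>
  let ?H = "\<lambda>i c. int (min (min c i) k)"
  show "heights A B k ?H" by (auto simp: heights_def link_def)
  have tel: "(\<Sum>c<A. melon w B i c) = lam w A B i" for i
    by (simp add: melon_def sum_lessThan_telescope[of "\<lambda>c. lam w c B i"])
  have nn: "0 \<le> melon w B i c" for i c using lam_mono_col by (simp add: melon_def)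
  have "(\<Sum>i<k. lam w A B i) = (\<Sum>i\<in>{..<k} \<inter> {..<B}. lam w A B i)"
    by (rule sum.mono_neutral_right) (auto intro!: lam_eq_0)
  also have "\<dots> \<le> (\<Sum>i\<in>{..<k} \<inter> {..<B}. row_weight A (melon w B i) (?H i) (?H (Suc i)))"
    unfolding tel[symmetric] row_weight_def
    using nn by (intro sum_mono) (auto intro!: mult_left_le)
  also have "\<dots> \<le> weight A B (melon w B) ?H"
    unfolding weight_def row_weight_def using nn
    by (intro sum_mono2) (auto intro!: sum_nonneg mult_nonneg_nonneg)
  finally show "(\<Sum>i<k. lam w A B i) \<le> weight A B (melon w B) ?H" .
qed

theorem height_maximum:
  assumes "0 < B"
  shows "heights A B k H \<Longrightarrow> weight A B (\<lambda>i c. w c (B - 1 - i)) H \<le> (\<Sum>i<k. lam w A B i)"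
    and "\<exists>H. heights A B k H \<and> (\<Sum>i<k. lam w A B i) \<le> weight A B (\<lambda>i c. w c (B - 1 - i)) H"
proof -
  show "weight A B (\<lambda>i c. w c (B - 1 - i)) H \<le> (\<Sum>i<k. lam w A B i)" if "heights A B k H"
    using dominated_melon(1)[OF assms, of A] that melon_weight_le unfolding dominated_def
    by (meson order_trans)
  show "\<exists>H. heights A B k H \<and> (\<Sum>i<k. lam w A B i) \<le> weight A B (\<lambda>i c. w c (B - 1 - i)) H"
    using dominated_melon(2)[OF assms, of A] melon_weight_ge[of A B k] unfolding dominated_def
    by (meson order_trans)
qed

end

section \<open>Disjoint paths and height functions\<close>

text \<open>The longest strictly increasing chain of \<open>Z\<close> in the first \<open>i\<close> rows and \<open>c\<close> columns. As rows are
  counted from the top, an up-right path contains at most one element of such a chain.\<close>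

fun chain_height :: "(nat \<Rightarrow> nat \<Rightarrow> bool) \<Rightarrow> nat \<Rightarrow> nat \<Rightarrow> int" where
  "chain_height Z 0 c = 0"
| "chain_height Z (Suc i) 0 = 0"
| "chain_height Z (Suc i) (Suc c) = (if Z i c then chain_height Z i c + 1
     else max (chain_height Z i (Suc c)) (chain_height Z (Suc i) c))"

lemma chain_height_0_right [simp]: "chain_height Z i 0 = 0"
  by (cases i) auto

text \<open>In the branch \<open>Z i c\<close> the recursion takes no maximum, so monotonicity there
  rests on the fact that one more row or column raises the height by at most one; hence the joint
  induction.\<close>

lemma chain_height_steps:
  "0 \<le> chain_height Z i c \<and> chain_height Z i c \<le> chain_height Z (Suc i) c
   \<and> chain_height Z i c \<le> chain_height Z i (Suc c)
   \<and> chain_height Z (Suc i) (Suc c) \<le> chain_height Z i c + 1"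
proof (induction "i + c" arbitrary: i c rule: less_induct)
  case less
  let ?h = "chain_height Z"
  have nn: "0 \<le> ?h i c"
    using less[of "i - 1" "c - 1"] by (cases i; cases c) (auto simp: max_def)
  have S1: "?h i (Suc c) \<le> ?h i c + 1"
  proof (cases i)
    case (Suc i')
    then show ?thesis using less[of i' c] by auto
  qed simp
  have S2: "?h (Suc i) c \<le> ?h i c + 1"
  proof (cases c)
    case (Suc c')
    then show ?thesis using less[of i c'] by auto
  qed simp
  have M1: "?h i c \<le> ?h (Suc i) c"
  proof (cases c)
    case (Suc c')
    have "?h i (Suc c') \<le> ?h i c' + 1"
    proof (cases i)
      case i: (Suc i')
      then show ?thesis using less[of i' c'] Suc by auto
    qed simp
    then show ?thesis using Suc by auto
  qed simp
  have M2: "?h i c \<le> ?h i (Suc c)"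
  proof (cases i)
    case (Suc i')
    have "?h (Suc i') c \<le> ?h i' c + 1"
    proof (cases c)
      case c: (Suc c')
      then show ?thesis using less[of i' c'] Suc by auto
    qed simp
    then show ?thesis using Suc by auto
  qed simp
  show ?case using nn S1 S2 M1 M2 by auto
qed

definition strict_chain :: "(nat \<times> nat) set \<Rightarrow> bool" where
  "strict_chain C \<longleftrightarrow> (\<forall>p\<in>C. \<forall>q\<in>C. p \<noteq> q \<longrightarrow>
     fst p < fst q \<and> snd p < snd q \<or> fst q < fst p \<and> snd q < snd p)"

lemma chain_height_realised:
  "\<exists>C. finite C \<and> strict_chain C \<and> chain_height Z i c = int (card C) \<and>
     (\<forall>p\<in>C. fst p < i \<and> snd p < c \<and> Z (fst p) (snd p))"
proof (induction Z i c rule: chain_height.induct)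
  case (1 Z c)
  show ?case by (rule exI[of _ "{}"]) (simp add: strict_chain_def)
next
  case (2 Z i)
  show ?case by (rule exI[of _ "{}"]) (simp add: strict_chain_def)
next
  case (3 Z i c)
  show ?case
  proof (cases "Z i c")
    case True
    then obtain C where C: "finite C" "strict_chain C" "chain_height Z i c = int (card C)"
      "\<forall>p\<in>C. fst p < i \<and> snd p < c \<and> Z (fst p) (snd p)"
      using 3(1) by blast
    have new: "(i, c) \<notin> C" using C(4) by auto
    show ?thesis
    proof (intro exI conjI)
      show "strict_chain (insert (i, c) C)"
        using C(2,4) unfolding strict_chain_def by simp
      show "chain_height Z (Suc i) (Suc c) = int (card (insert (i, c) C))"
        using True C(1,3) new by simp
      show "\<forall>p\<in>insert (i, c) C. fst p < Suc i \<and> snd p < Suc c \<and> Z (fst p) (snd p)"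
        using C(4) True by (simp add: less_SucI)
    qed (use C(1) in simp)
  next
    case False
    then have "chain_height Z (Suc i) (Suc c) = chain_height Z i (Suc c) \<or>
       chain_height Z (Suc i) (Suc c) = chain_height Z (Suc i) c" by (simp add: max_def)
    then show ?thesis
    proof
      assume e: "chain_height Z (Suc i) (Suc c) = chain_height Z i (Suc c)"
      show ?thesis unfolding e using 3(2)[OF False] by (meson less_SucI)
    next
      assume e: "chain_height Z (Suc i) (Suc c) = chain_height Z (Suc i) c"
      show ?thesis unfolding e using 3(3)[OF False] by (meson less_SucI)
    qed
  qed
qed

section \<open>Up-right paths as lists, and the cells of the rectangle\<close>

lemma up_right_Cons_le:
  "up_right (z # zs) \<Longrightarrow> z' \<in> set zs \<Longrightarrow> fst z \<le> fst z' \<and> snd z \<le> snd z'"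
proof (induction zs arbitrary: z)
  case (Cons y zs)
  then have "fst z \<le> fst y \<and> snd z \<le> snd y" "up_right (y # zs)" by auto
  then have "z' = y \<or> fst y \<le> fst z' \<and> snd y \<le> snd z'" using Cons.IH[of y] Cons.prems(2) by simp metis
  then show ?case using \<open>fst z \<le> fst y \<and> snd z \<le> snd y\<close> by auto
qed simp

lemma up_right_tl: "up_right (z # zs) \<Longrightarrow> up_right zs"
  by (cases zs) auto

lemma up_right_comparable:
  "up_right zs \<Longrightarrow> z \<in> set zs \<Longrightarrow> z' \<in> set zs \<Longrightarrow>
     fst z \<le> fst z' \<and> snd z \<le> snd z' \<or> fst z' \<le> fst z \<and> snd z' \<le> snd z"
proof (induction zs)
  case (Cons y zs)
  have "up_right zs" using Cons.prems(1) by (rule up_right_tl)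
  then have IH: "z \<in> set zs \<Longrightarrow> z' \<in> set zs \<Longrightarrow> ?case" by (rule Cons.IH)
  show ?case
  proof (cases "z = y \<or> z' = y")
    case True
    then show ?thesis
      using Cons.prems(2,3) up_right_Cons_le[OF Cons.prems(1)] by (metis order_refl set_ConsD)
  next
    case False
    then show ?thesis using IH Cons.prems(2,3) by simp
  qed
qed simp

lemma up_right_append:
  "up_right xs \<Longrightarrow> up_right ys \<Longrightarrow>
   xs = [] \<or> ys = [] \<or> hd ys = (fst (last xs) + 1, snd (last xs)) \<or> hd ys = (fst (last xs), snd (last xs) + 1)
   \<Longrightarrow> up_right (xs @ ys)"
proof (induction xs)
  case (Cons x xs)
  show ?case
  proof (cases xs)
    case Nil
    then show ?thesis using Cons.prems by (cases ys) auto
  next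
    case (Cons x' xs')
    then show ?thesis using Cons.IH Cons.prems by auto
  qed
qed simp

lemma up_right_column: "up_right (map (\<lambda>r. (c, r)) [lo..lo + int n])"
proof (induction n)
  case (Suc n)
  have "[lo..lo + int (Suc n)] = [lo..lo + int n] @ [lo + int (Suc n)]"
    using upto_rec2[of lo "lo + int (Suc n)"] by simp
  moreover have "last (map (\<lambda>r. (c, r)) [lo..lo + int n]) = (c, lo + int n)"
    using upto_rec2[of lo "lo + int n"] by simp
  ultimately show ?case using Suc by (auto intro!: up_right_append simp: last_map)
qed simp

definition cell :: "nat \<Rightarrow> nat \<Rightarrow> nat \<Rightarrow> int \<times> int" where
  "cell B i c = (int c, int (B - 1 - i))"

lemma cell_eq_iff: "i < B \<Longrightarrow> i' < B \<Longrightarrow> cell B i c = cell B i' c' \<longleftrightarrow> i = i' \<and> c = c'"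
  by (auto simp: cell_def)

definition row_env :: "(int \<times> int \<Rightarrow> nat) \<Rightarrow> nat \<Rightarrow> nat \<Rightarrow> nat \<Rightarrow> int" where
  "row_env \<omega> B i c = int (\<omega> (cell B i c))"

lemma weight_as_double_sum:
  "weight A B u H = (\<Sum>(i, c)\<in>{..<B} \<times> {..<A}. u i c * (H (Suc i) (Suc c) - H i c))"
  by (simp add: weight_def row_weight_def sum.cartesian_product)

lemma rect_image_cell:
  assumes "0 < A" "0 < B"
  shows "rect (0, 0) (int A - 1, int B - 1) = (\<lambda>(i, c). cell B i c) ` ({..<B} \<times> {..<A})"
proof (intro set_eqI iffI)
  fix z assume "z \<in> rect (0, 0) (int A - 1, int B - 1)"
  then have z: "0 \<le> fst z" "fst z < int A" "0 \<le> snd z" "snd z < int B" by (auto simp: rect_def)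
  then have "z = cell B (B - 1 - nat (snd z)) (nat (fst z))"
    by (auto simp: cell_def prod_eq_iff)
  moreover have "nat (fst z) < A" "B - 1 - nat (snd z) < B" using z assms by auto
  ultimately show "z \<in> (\<lambda>(i, c). cell B i c) ` ({..<B} \<times> {..<A})"
    by (intro image_eqI[of _ _ "(B - 1 - nat (snd z), nat (fst z))"]) auto
qed (use assms in \<open>auto simp: rect_def cell_def\<close>)

lemma sum_rect_subset:
  assumes pos: "0 < A" "0 < B" and U: "U \<subseteq> rect (0, 0) (int A - 1, int B - 1)"
  shows "int (\<Sum>z\<in>U. \<omega> z)
    = (\<Sum>(i, c)\<in>{..<B} \<times> {..<A}. if cell B i c \<in> U then row_env \<omega> B i c else 0)"
proof -
  have "finite (rect (0, 0) (int A - 1, int B - 1))" unfolding rect_image_cell[OF pos] by simp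
  then have "int (\<Sum>z\<in>U. \<omega> z)
      = (\<Sum>z\<in>rect (0, 0) (int A - 1, int B - 1). if z \<in> U then int (\<omega> z) else 0)"
    using U by (simp add: sum.inter_restrict[symmetric] Int_absorb1)
  also have "\<dots> = (\<Sum>(i, c)\<in>{..<B} \<times> {..<A}. if cell B i c \<in> U then row_env \<omega> B i c else 0)"
  proof -
    have "inj_on (\<lambda>(i, c). cell B i c) ({..<B} \<times> {..<A})" by (auto simp: inj_on_def cell_eq_iff)
    then show ?thesis
      by (simp add: rect_image_cell[OF pos] sum.reindex o_def case_prod_unfold row_env_def cong: if_cong)
  qed
  finally show ?thesis .
qed

lemma heights_of_paths:
  assumes pos: "0 < A" "0 < B"
    and path: "\<And>i. i < k \<Longrightarrow> up_right (\<gamma> i)"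
    and sub: "\<And>i. i < k \<Longrightarrow> set (\<gamma> i) \<subseteq> rect (0, 0) (int A - 1, int B - 1)"
    and disj: "\<And>i j. i < k \<Longrightarrow> j < k \<Longrightarrow> i \<noteq> j \<Longrightarrow> set (\<gamma> i) \<inter> set (\<gamma> j) = {}"
  shows "\<exists>H. heights A B k H \<and>
    int (\<Sum>i<k. \<Sum>z\<in>set (\<gamma> i). \<omega> z) \<le> weight A B (row_env \<omega> B) H"
proof (intro exI conjI)
  define U where "U = (\<Union>i<k. set (\<gamma> i))"
  define Z where "Z i c = (cell B i c \<in> U)" for i c
  let ?H = "chain_height Z"
  have "?H B A \<le> int k"
  proof -
    obtain C where C: "finite C" "strict_chain C" "?H B A = int (card C)"
      "\<forall>p\<in>C. fst p < B \<and> snd p < A \<and> Z (fst p) (snd p)"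
      using chain_height_realised by blast
    have "\<forall>p\<in>C. \<exists>t<k. cell B (fst p) (snd p) \<in> set (\<gamma> t)"
      using C(4) by (auto simp: Z_def U_def)
    then obtain g where g: "\<And>p. p \<in> C \<Longrightarrow> g p < k \<and> cell B (fst p) (snd p) \<in> set (\<gamma> (g p))"
      by metis
    \<comment> \<open>Pigeonhole: a chain moves right and down, a path right and up, so they share
      at most one cell, and \<open>k\<close> paths admit at most \<open>k\<close> chain
      elements.\<close>
    have "inj_on g C"
    proof (rule inj_onI, rule ccontr)
      fix p q assume pq: "p \<in> C" "q \<in> C" "g p = g q" "p \<noteq> q"
      have B: "fst p < B" "fst q < B" using pq C(4) by auto
      have "fst (cell B (fst p) (snd p)) \<le> fst (cell B (fst q) (snd q)) \<and> snd (cell B (fst p) (snd p)) \<le> snd (cell B (fst q) (snd q))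
         \<or> fst (cell B (fst q) (snd q)) \<le> fst (cell B (fst p) (snd p)) \<and> snd (cell B (fst q) (snd q)) \<le> snd (cell B (fst p) (snd p))"
        using up_right_comparable[OF path] g[OF pq(1)] g[OF pq(2)] pq(3) by metis
      moreover have "fst p < fst q \<and> snd p < snd q \<or> fst q < fst p \<and> snd q < snd p"
        using C(2) pq unfolding strict_chain_def by blast
      ultimately show False using B by (auto simp: cell_def)
    qed
    then have "card C \<le> card {..<k}" using g by (intro card_inj_on_le[of g]) auto
    then show ?thesis using C(3) by simp
  qed
  then show "heights A B k ?H"
    using chain_height_steps[of Z] by (auto simp: heights_def link_def simp del: chain_height.simps(3))
  have "int (\<Sum>i<k. \<Sum>z\<in>set (\<gamma> i). \<omega> z) = int (\<Sum>z\<in>U. \<omega> z)"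
    unfolding U_def using disj by (subst sum.UNION_disjoint) auto
  also have "\<dots> = (\<Sum>(i, c)\<in>{..<B} \<times> {..<A}. if Z i c then row_env \<omega> B i c else 0)"
    unfolding Z_def using sub by (intro sum_rect_subset[OF pos]) (auto simp: U_def)
  also have "\<dots> \<le> weight A B (row_env \<omega> B) ?H"
    unfolding weight_as_double_sum
  proof (intro sum_mono, clarify)
    fix i c
    have "?H i c \<le> ?H (Suc i) (Suc c)"
      using chain_height_steps[of Z i c] chain_height_steps[of Z "Suc i" c] by linarith
    moreover have "Z i c \<Longrightarrow> ?H (Suc i) (Suc c) = ?H i c + 1" by simp
    ultimately show "(if Z i c then row_env \<omega> B i c else 0) \<le> row_env \<omega> B i c * (?H (Suc i) (Suc c) - ?H i c)"
      by (cases "Z i c") (simp_all add: row_env_def del: chain_height.simps(3))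
  qed
  finally show "int (\<Sum>i<k. \<Sum>z\<in>set (\<gamma> i). \<omega> z) \<le> weight A B (row_env \<omega> B) ?H" .
qed

section \<open>Reading disjoint paths off a height function\<close>

lemma heights_mono_row:
  assumes "heights A B k H" "i \<le> i'" "i' \<le> B" "c \<le> A"
  shows "H i c \<le> H i' c"
  using assms(2,3)
proof (induction i' rule: dec_induct)
  case (step n)
  then have "H n c \<le> H (Suc n) c" using assms(1,4) by (auto simp: heights_def link_def)
  then show ?case using step by auto
qed simp

lemma crossing:
  fixes f :: "nat \<Rightarrow> int"
  assumes "f 0 < t" "t \<le> f B" shows "\<exists>i<B. f i < t \<and> t \<le> f (Suc i)"
  using assms
proof (induction B)
  case (Suc B)
  then show ?case by (cases "t \<le> f B") (auto simp: less_Suc_eq)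
qed simp

definition level_cells :: "nat \<Rightarrow> (nat \<Rightarrow> nat \<Rightarrow> int) \<Rightarrow> int \<Rightarrow> nat \<Rightarrow> (int \<times> int) set" where
  "level_cells B H t c = {cell B i c' | i c'. i < B \<and> c' < c \<and> H i c' < t \<and> t \<le> H (Suc i) (Suc c')}"

text \<open>The path is built column by column. Heights at \<open>c\<close> live on the boundary
  after column \<open>c - 1\<close>, so the row where they cross level \<open>t\<close> is where the
  path leaves that column; column \<open>c\<close> is then climbed up to the crossing row of the
  heights at \<open>Suc c\<close>.\<close>

lemma level_path:
  assumes H: "heights A B k H" and t: "1 \<le> t"
  shows "c \<le> A \<Longrightarrow> \<exists>xs. up_right xs \<and> set xs = level_cells B H t c \<and> (H B c < t \<longrightarrow> xs = []) \<and>
     (\<forall>i<B. H i c < t \<and> t \<le> H (Suc i) c \<longrightarrow> xs \<noteq> [] \<and> last xs = (int c - 1, int (B - 1 - i)))"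
proof (induction c)
  case 0
  have "H i 0 = 0" if "i \<le> B" for i
    using H that by (cases i) (auto simp: heights_def link_def)
  then show ?case using t by (intro exI[of _ "[]"]) (auto simp: level_cells_def)
next
  case (Suc c)
  then obtain xs where xs: "up_right xs" "set xs = level_cells B H t c" "H B c < t \<longrightarrow> xs = []"
     "\<And>i. i < B \<Longrightarrow> H i c < t \<Longrightarrow> t \<le> H (Suc i) c \<Longrightarrow> xs \<noteq> [] \<and> last xs = (int c - 1, int (B - 1 - i))"
    by auto
  have H0: "H 0 c' = 0" for c' using H by (auto simp: heights_def)
  have mono: "H i c' \<le> H i' c'" if "i \<le> i'" "i' \<le> B" "c' \<le> Suc c" for i i' c'
    using heights_mono_row[OF H] that Suc.prems by auto
  have colmono: "H i c \<le> H i (Suc c)" if "i \<le> B" for i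
    using H that Suc.prems by (cases i) (auto simp: heights_def link_def)
  show ?case
  proof (cases "t \<le> H B (Suc c)")
    case False
    then have e: "H i (Suc c) < t" if "i \<le> B" for i using mono[of i B "Suc c"] that by auto
    have "level_cells B H t (Suc c) = level_cells B H t c"
    proof -
      have "\<not> t \<le> H (Suc i) (Suc c)" if "i < B" for i using e[of "Suc i"] that by auto
      then show ?thesis unfolding level_cells_def by (auto simp: less_Suc_eq)
    qed
    moreover have "xs = []" using xs(3) e[of B] colmono[of B] by auto
    moreover have "\<not> t \<le> H (Suc i) (Suc c)" if "i < B" for i using e[of "Suc i"] that by auto
    ultimately show ?thesis using xs(1,2) by (intro exI[of _ "[]"]) auto
  next
    case True
    then obtain i1 where i1: "i1 < B" "H i1 (Suc c) < t" "t \<le> H (Suc i1) (Suc c)"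
      using crossing[of "\<lambda>i. H i (Suc c)" t B] H0 t by auto
    have i1_unique: "i = i1" if "i < B" "H i (Suc c) < t" "t \<le> H (Suc i) (Suc c)" for i
      using mono[of "Suc i" i1 "Suc c"] mono[of "Suc i1" i "Suc c"] that i1
      by (cases i i1 rule: linorder_cases) auto
    have "\<exists>i0. i0 < B \<and> i1 \<le> i0 \<and> (\<forall>i<B. H i c < t \<longleftrightarrow> i \<le> i0) \<and>
       (xs = [] \<or> last xs = (int c - 1, int (B - 1 - i0)))"
    proof (cases "t \<le> H B c")
      case True
      then obtain i0 where i0: "i0 < B" "H i0 c < t" "t \<le> H (Suc i0) c"
        using crossing[of "\<lambda>i. H i c" t B] H0 t by auto
      have "H i c < t \<longleftrightarrow> i \<le> i0" if "i < B" for i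
        using mono[of i i0 c] mono[of "Suc i0" i c] i0 that by (cases "i \<le> i0") auto
      moreover have "i1 \<le> i0"
      proof (rule ccontr)
        assume "\<not> i1 \<le> i0"
        then show False
          using mono[of "Suc i0" i1 "Suc c"] colmono[of "Suc i0"] i0 i1 by auto
      qed
      ultimately show ?thesis using i0 xs(4)[OF i0] by auto
    next
      case False
      \<comment> \<open>The level has not been reached before this column, so the path enters here
        at the bottom row \<open>B - 1\<close>.\<close>
      then have "H i c < t" if "i < B" for i using mono[of i B c] that by auto
      then show ?thesis using xs(3) False i1 by (intro exI[of _ "B - 1"]) auto
    qed
    then obtain i0 where i0: "i0 < B" "i1 \<le> i0" "\<And>i. i < B \<Longrightarrow> H i c < t \<longleftrightarrow> i \<le> i0"
       "xs = [] \<or> last xs = (int c - 1, int (B - 1 - i0))" by blast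
    define ys where "ys = map (\<lambda>r. (int c, r)) [int (B - 1 - i0)..int (B - 1 - i1)]"
    have le: "int (B - 1 - i1) = int (B - 1 - i0) + int (i0 - i1)" using i0 i1 by auto
    have le': "int (B - 1 - i0) \<le> int (B - 1 - i1)" using le by simp
    have hd_ys: "ys \<noteq> []" "hd ys = (int c, int (B - 1 - i0))"
      using upto_rec1[OF le'] by (simp_all add: ys_def)
    have last_ys: "last ys = (int c, int (B - 1 - i1))"
      using upto_rec2[OF le'] by (simp add: ys_def)
    note ys = hd_ys last_ys
    have "up_right ys" unfolding ys_def le by (rule up_right_column)
    then have up: "up_right (xs @ ys)"
      using xs(1) ys i0(4) by (intro up_right_append) auto
    have col: "t \<le> H (Suc i) (Suc c) \<longleftrightarrow> i1 \<le> i" if "i < B" for i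
      using mono[of "Suc i1" "Suc i" "Suc c"] mono[of "Suc i" i1 "Suc c"] i1 that
      by (cases "i1 \<le> i") auto
    have "set ys = {cell B i c | i. i < B \<and> i1 \<le> i \<and> i \<le> i0}"
    proof (intro set_eqI iffI)
      fix z assume "z \<in> set ys"
      then obtain r where r: "z = (int c, r)" "int (B - 1 - i0) \<le> r" "r \<le> int (B - 1 - i1)"
        by (auto simp: ys_def)
      have "z = cell B (B - 1 - nat r) c" "i1 \<le> B - 1 - nat r" "B - 1 - nat r \<le> i0"
        using r i0 i1 by (auto simp: cell_def)
      then show "z \<in> {cell B i c | i. i < B \<and> i1 \<le> i \<and> i \<le> i0}" using i0(1) by auto
    next
      fix z assume "z \<in> {cell B i c | i. i < B \<and> i1 \<le> i \<and> i \<le> i0}"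
      then obtain i where i: "z = (int c, int (B - 1 - i))" "i1 \<le> i" "i \<le> i0"
        by (auto simp: cell_def)
      then have "int (B - 1 - i) \<in> {int (B - 1 - i0)..int (B - 1 - i1)}" by auto
      then show "z \<in> set ys" using i(1) by (simp add: ys_def)
    qed
    also have "\<dots> = {cell B i c | i. i < B \<and> H i c < t \<and> t \<le> H (Suc i) (Suc c)}"
      using i0(3) col by auto
    finally have "set (xs @ ys) = level_cells B H t (Suc c)"
      using xs(2) unfolding level_cells_def by (auto simp: less_Suc_eq)
    then show ?thesis using up ys i1_unique True by (intro exI[of _ "xs @ ys"]) auto
  qed
qed

lemma paths_of_heights:
  assumes pos: "0 < A" "0 < B" and H: "heights A B k H"
  shows "\<exists>\<gamma>. (\<forall>i<k. up_right (\<gamma> i) \<and> set (\<gamma> i) \<subseteq> rect (0, 0) (int A - 1, int B - 1)) \<and>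
     (\<forall>i<k. \<forall>j<k. i \<noteq> j \<longrightarrow> set (\<gamma> i) \<inter> set (\<gamma> j) = {}) \<and>
     weight A B (row_env \<omega> B) H \<le> int (\<Sum>i<k. \<Sum>z\<in>set (\<gamma> i). \<omega> z)"
proof -
  have "\<exists>xs. up_right xs \<and> set xs = level_cells B H (int s + 1) A" for s
    using level_path[OF H, of "int s + 1" A] by auto
  then obtain \<gamma> where \<gamma>: "\<And>s. up_right (\<gamma> s) \<and> set (\<gamma> s) = level_cells B H (int s + 1) A"
    by metis
  have step: "H (Suc i) (Suc c) \<le> H i c + 1 \<and> H i c \<le> H (Suc i) (Suc c) \<and> 0 \<le> H i c
      \<and> H (Suc i) (Suc c) \<le> int k"
    if ic: "i < B" "c < A" for i c
  proof -
    have l: "link A (H i) (H (Suc i))" using H ic by (auto simp: heights_def)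
    have "H 0 c \<le> H i c" using heights_mono_row[OF H, of 0 i c] ic by auto
    moreover have "H (Suc i) (Suc c) \<le> H B (Suc c)"
      using heights_mono_row[OF H, of "Suc i" B "Suc c"] ic by auto
    moreover have "H B (Suc c) \<le> H B A"
    proof (rule inc_induct[of "Suc c" A "\<lambda>c. H B c \<le> H B A"])
      fix n assume n: "Suc c \<le> n" "n < A" "H B (Suc n) \<le> H B A"
      obtain B' where B: "B = Suc B'" using pos by (cases B) auto
      then have "link A (H B') (H B)" using H by (auto simp: heights_def)
      then have "H B n \<le> H B (Suc n)" using n by (auto simp: link_def)
      then show "H B n \<le> H B A" using n by auto
    qed (use ic in auto)
    moreover have "H i c \<le> H i (Suc c)" "H i (Suc c) \<le> H (Suc i) (Suc c)"
      "H (Suc i) (Suc c) \<le> H i c + 1"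
      using l ic by (auto simp: link_def)
    ultimately show ?thesis using H by (auto simp: heights_def)
  qed
  have sub: "set (\<gamma> s) \<subseteq> rect (0, 0) (int A - 1, int B - 1)" for s
  proof
    fix z assume "z \<in> set (\<gamma> s)"
    then have "z \<in> level_cells B H (int s + 1) A" using \<gamma> by simp
    then show "z \<in> rect (0, 0) (int A - 1, int B - 1)"
      unfolding rect_image_cell[OF pos] level_cells_def by auto
  qed
  have disj: "set (\<gamma> s) \<inter> set (\<gamma> s') = {}" if "s \<noteq> s'" for s s'
  proof (rule ccontr)
    assume "set (\<gamma> s) \<inter> set (\<gamma> s') \<noteq> {}"
    then obtain z where "z \<in> level_cells B H (int s + 1) A" "z \<in> level_cells B H (int s' + 1) A"
      using \<gamma> by auto
    then obtain i c i' c' where ic: "i < B" "c < A" "i' < B" "cell B i c = cell B i' c'"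
      "H i c < int s + 1" "int s + 1 \<le> H (Suc i) (Suc c)"
      "H i' c' < int s' + 1" "int s' + 1 \<le> H (Suc i') (Suc c')"
      unfolding level_cells_def by blast
    then have e: "i' = i" "c' = c" by (simp_all add: cell_eq_iff)
    show False using step[OF ic(1,2)] that ic(5-8) unfolding e by linarith
  qed
  have cover: "\<exists>s<k. H i c < int s + 1 \<and> int s + 1 \<le> H (Suc i) (Suc c)"
    if "i < B" "c < A" "H i c \<noteq> H (Suc i) (Suc c)" for i c
    \<comment> \<open>The height rises by one across a used cell, so the level passed is
      \<open>H i c + 1\<close>, which belongs to path number \<open>H i c\<close>.\<close>
    using step[OF that(1,2)] that(3) by (intro exI[of _ "nat (H i c)"]) auto
  define U where "U = (\<Union>s<k. set (\<gamma> s))"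
  have "weight A B (row_env \<omega> B) H
     \<le> (\<Sum>(i, c)\<in>{..<B} \<times> {..<A}. if cell B i c \<in> U then row_env \<omega> B i c else 0)"
    unfolding weight_as_double_sum
  proof (intro sum_mono, clarify)
    fix i c assume ic: "i < B" "c < A"
    show "row_env \<omega> B i c * (H (Suc i) (Suc c) - H i c)
      \<le> (if cell B i c \<in> U then row_env \<omega> B i c else 0)"
    proof (cases "H i c = H (Suc i) (Suc c)")
      case False
      then obtain s where "s < k" "cell B i c \<in> level_cells B H (int s + 1) A"
        using cover[OF ic] ic by (auto simp: level_cells_def)
      then have "cell B i c \<in> U" using \<gamma> by (auto simp: U_def)
      then show ?thesis using step[OF ic] by (auto simp: row_env_def intro!: mult_left_le)
    qed (auto simp: row_env_def)
  qed
  also have "\<dots> = int (\<Sum>z\<in>U. \<omega> z)"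
    using sub by (intro sum_rect_subset[OF pos, symmetric]) (auto simp: U_def)
  also have "\<dots> = int (\<Sum>i<k. \<Sum>z\<in>set (\<gamma> i). \<omega> z)"
    unfolding U_def using disj by (subst sum.UNION_disjoint) auto
  finally show ?thesis using \<gamma> sub disj by blast
qed

definition grid_weight :: "(int \<times> int \<Rightarrow> nat) \<Rightarrow> nat \<Rightarrow> nat \<Rightarrow> int" where
  "grid_weight \<omega> a b = int (\<omega> (int a, int b))"

lemma nonneg_grid_weight: "nonneg_weights (grid_weight \<omega>)"
  by unfold_locales (simp add: grid_weight_def)

theorem LPP_eq_sum_lam:
  "int (LPP \<omega> k (0, 0) (int a, int b)) = (\<Sum>i<k. lam (grid_weight \<omega>) (Suc a) (Suc b) i)"
proof -
  interpret nonneg_weights "grid_weight \<omega>" by (rule nonneg_grid_weight)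
  let ?A = "Suc a" and ?B = "Suc b"
  let ?V = "\<Sum>i<k. lam (grid_weight \<omega>) ?A ?B i"
  define S where "S = {(\<Sum>i<k. \<Sum>z\<in>set (\<gamma> i). \<omega> z) | \<gamma>.
      (\<forall>i<k. up_right (\<gamma> i) \<and> set (\<gamma> i) \<subseteq> rect (0, 0) (int a, int b)) \<and>
      (\<forall>i<k. \<forall>j<k. i \<noteq> j \<longrightarrow> set (\<gamma> i) \<inter> set (\<gamma> j) = {})}"
  have env: "row_env \<omega> ?B = (\<lambda>i c. grid_weight \<omega> c (?B - 1 - i))"
    by (intro ext) (simp add: row_env_def grid_weight_def cell_def)
  have upper: "int v \<le> ?V" if v: "v \<in> S" for v
  proof -
    obtain \<gamma> where \<gamma>: "v = (\<Sum>i<k. \<Sum>z\<in>set (\<gamma> i). \<omega> z)"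
      "\<And>i. i < k \<Longrightarrow> up_right (\<gamma> i)" "\<And>i. i < k \<Longrightarrow> set (\<gamma> i) \<subseteq> rect (0, 0) (int a, int b)"
      "\<And>i j. i < k \<Longrightarrow> j < k \<Longrightarrow> i \<noteq> j \<Longrightarrow> set (\<gamma> i) \<inter> set (\<gamma> j) = {}"
      using v unfolding S_def by blast
    obtain H where "heights ?A ?B k H" "int v \<le> weight ?A ?B (row_env \<omega> ?B) H"
      using heights_of_paths[of ?A ?B k \<gamma> \<omega>] \<gamma> by auto
    then show ?thesis using height_maximum(1)[of ?B ?A k H] unfolding env by auto
  qed
  obtain H where H: "heights ?A ?B k H" "?V \<le> weight ?A ?B (row_env \<omega> ?B) H"
    using height_maximum(2)[of ?B ?A k] unfolding env by auto
  obtain \<gamma> where \<gamma>: "\<forall>i<k. up_right (\<gamma> i) \<and> set (\<gamma> i) \<subseteq> rect (0, 0) (int a, int b)"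
     "\<forall>i<k. \<forall>j<k. i \<noteq> j \<longrightarrow> set (\<gamma> i) \<inter> set (\<gamma> j) = {}"
     "weight ?A ?B (row_env \<omega> ?B) H \<le> int (\<Sum>i<k. \<Sum>z\<in>set (\<gamma> i). \<omega> z)"
    using paths_of_heights[OF _ _ H(1), of \<omega>] by auto
  define v where "v = (\<Sum>i<k. \<Sum>z\<in>set (\<gamma> i). \<omega> z)"
  have vS: "v \<in> S" unfolding S_def v_def using \<gamma> by blast
  have v: "int v = ?V" using upper[OF vS] \<gamma>(3) H(2) unfolding v_def by linarith
  have le: "v' \<le> v" if "v' \<in> S" for v' using upper[OF that] v by linarith
  have "S \<subseteq> {..v}" using le by blast
  then have "finite S" by (rule finite_subset) simp
  then have "Max S = v" using le vS by (intro Max_eqI)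
  then show ?thesis using v unfolding LPP_def S_def by simp
qed

corollary Wk_eq_lam:
  "Wk \<omega> (Suc i) (int a, int b) = lam (grid_weight \<omega>) (Suc a) (Suc b) i"
  by (simp add: Wk_def LPP_eq_sum_lam)

section \<open>Inverting the growth process\<close>

definition level_sum :: "nat \<Rightarrow> (nat \<Rightarrow> nat \<Rightarrow> nat \<Rightarrow> int) \<Rightarrow> nat \<Rightarrow> int" where
  "level_sum K P m = (\<Sum>a\<le>m. \<Sum>i<K. P a (m - a) i)"

definition interlacing_levels :: "nat \<Rightarrow> (nat \<Rightarrow> nat \<Rightarrow> nat \<Rightarrow> int) \<Rightarrow> bool" where
  "interlacing_levels N P \<longleftrightarrow>
     (\<forall>a b i. a + b = N \<or> a + b = Suc N \<longrightarrow> 0 \<le> P a b i \<and> (min a b \<le> i \<longrightarrow> P a b i = 0)) \<and>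
     (\<forall>a b i. a + b = N \<longrightarrow> P a b i \<le> P (Suc a) b i \<and> P a b i \<le> P a (Suc b) i \<and>
        P (Suc a) b (Suc i) \<le> P a b i \<and> P a (Suc b) (Suc i) \<le> P a b i)"

definition prev_level :: "nat \<Rightarrow> (nat \<Rightarrow> nat \<Rightarrow> nat \<Rightarrow> int) \<Rightarrow> nat \<Rightarrow> nat \<Rightarrow> nat \<Rightarrow> int" where
  "prev_level N P a b i = (if a + b = N then
      min (P (Suc a) b i) (P a (Suc b) i) + max (P (Suc a) b (Suc i)) (P a (Suc b) (Suc i))
        - P (Suc a) (Suc b) (Suc i)
    else P a b i)"

text \<open>The new entry is the reflection of \<open>P (Suc a) (Suc b) (Suc i)\<close> in the
  interval from the larger of the neighbours' lines \<open>Suc i\<close> to the smaller of their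
  lines \<open>i\<close>. Interlacing says that an entry lies in this interval, and reflection
  preserves it.\<close>

lemma interlacing_prev_level:
  assumes "interlacing_levels (Suc N) P"
  shows "interlacing_levels N (prev_level N P)"
proof -
  have nn: "0 \<le> P a b i" if "a + b = Suc N \<or> a + b = Suc (Suc N)" for a b i
    using assms that unfolding interlacing_levels_def by blast
  have z: "P a b i = 0" if "a + b = Suc N \<or> a + b = Suc (Suc N)" "min a b \<le> i" for a b i
    using assms that unfolding interlacing_levels_def by blast
  have I: "P a b i \<le> P (Suc a) b i" "P a b i \<le> P a (Suc b) i"
        "P (Suc a) b (Suc i) \<le> P a b i" "P a (Suc b) (Suc i) \<le> P a b i"
    if "a + b = Suc N" for a b i
    using assms that unfolding interlacing_levels_def by blast+
  let ?Q = "prev_level N P"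
  have il: "?Q a b i \<le> P (Suc a) b i \<and> ?Q a b i \<le> P a (Suc b) i \<and>
        P (Suc a) b (Suc i) \<le> ?Q a b i \<and> P a (Suc b) (Suc i) \<le> ?Q a b i" if "a + b = N" for a b i
    using that I(2)[of "Suc a" b "Suc i"] I(4)[of "Suc a" b i] I(1)[of a "Suc b" "Suc i"]
      I(3)[of a "Suc b" i] by (auto simp: prev_level_def min_def max_def)
  have "0 \<le> ?Q a b i" if "a + b = N" for a b i
    using il[OF that, of i] nn[of "Suc a" b "Suc i"] that by auto
  moreover have "?Q a b i = 0" if ab: "a + b = N" and i: "min a b \<le> i" for a b i
  proof -
    have "P (Suc a) b (Suc i) = 0" "P a (Suc b) (Suc i) = 0" "P (Suc a) (Suc b) (Suc i) = 0"
      using ab i by (auto intro!: z)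
    moreover have "P (Suc a) b i = 0 \<or> P a (Suc b) i = 0"
      using ab i by (auto intro!: z simp: min_le_iff_disj)
    ultimately show ?thesis using nn[of "Suc a" b i] nn[of a "Suc b" i] ab by (auto simp: prev_level_def)
  qed
  moreover have "?Q a b i = P a b i" if "a + b = Suc N" for a b i
    using that by (simp add: prev_level_def)
  ultimately show ?thesis
    using il nn z unfolding interlacing_levels_def by auto
qed

text \<open>Summing the growth rule over all lines of a unit square, \<open>max\<close> and
  \<open>min\<close> combine to the two neighbours. Over all squares each nonempty shape of the
  middle level occurs twice, and the second difference of the level sums is the total weight of one
  antidiagonal.\<close>

lemma level_sum_prev:
  assumes P: "interlacing_levels (Suc N) P" and K: "Suc (Suc N) \<le> K"
  shows "level_sum K P (Suc (Suc N)) + level_sum K (prev_level N P) N =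
    2 * level_sum K P (Suc N) +
    (\<Sum>a\<le>N. P (Suc a) (Suc (N - a)) 0 - max (P (Suc a) (N - a) 0) (P a (Suc (N - a)) 0))"
proof -
  have z: "P a b i = 0" if "a + b = Suc N \<or> a + b = Suc (Suc N)" "min a b \<le> i" for a b i
    using P that unfolding interlacing_levels_def by blast
  obtain K' where K': "K = Suc K'" "Suc N \<le> K'" using K by (cases K) auto
  let ?Q = "prev_level N P"
  have cell: "(\<Sum>i<K. P (Suc a) (Suc b) i) + (\<Sum>i<K. ?Q a b i) =
     (\<Sum>i<K. P (Suc a) b i) + (\<Sum>i<K. P a (Suc b) i)
     + (P (Suc a) (Suc b) 0 - max (P (Suc a) b 0) (P a (Suc b) 0))" if ab: "a + b = N" for a b
  proof -
    let ?mx = "\<lambda>i. max (P (Suc a) b i) (P a (Suc b) i)"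
    let ?mn = "\<lambda>i. min (P (Suc a) b i) (P a (Suc b) i)"
    \<comment> \<open>The rule pairs line \<open>Suc i\<close> of one corner with line
      \<open>i\<close> of the other; since line \<open>K'\<close> vanishes, the shift by one loses
      nothing.\<close>
    have "?Q a b K' = 0"
      using interlacing_prev_level[OF P] ab K' unfolding interlacing_levels_def by auto
    then have "(\<Sum>i<K. P (Suc a) (Suc b) i) + (\<Sum>i<K. ?Q a b i) =
       P (Suc a) (Suc b) 0 + (\<Sum>i<K'. P (Suc a) (Suc b) (Suc i) + ?Q a b i)"
      unfolding K' sum.lessThan_Suc_shift[of "\<lambda>i. P (Suc a) (Suc b) i"] by (simp add: sum.distrib)
    also have "(\<Sum>i<K'. P (Suc a) (Suc b) (Suc i) + ?Q a b i) = (\<Sum>i<K'. ?mn i + ?mx (Suc i))"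
      using ab by (intro sum.cong) (auto simp: prev_level_def)
    also have "\<dots> = (\<Sum>i<K'. ?mn i) + (\<Sum>i<K'. ?mx (Suc i))" by (rule sum.distrib)
    also have "(\<Sum>i<K'. ?mn i) = (\<Sum>i<K. ?mn i)"
    proof -
      have "P (Suc a) b K' = 0" "P a (Suc b) K' = 0" using ab K' by (auto intro!: z)
      then show ?thesis by (simp add: K')
    qed
    also have "(\<Sum>i<K'. ?mx (Suc i)) = (\<Sum>i<K. ?mx i) - ?mx 0"
      unfolding K' sum.lessThan_Suc_shift[of ?mx] by simp
    also have "P (Suc a) (Suc b) 0 + ((\<Sum>i<K. ?mn i) + ((\<Sum>i<K. ?mx i) - ?mx 0))
       = (\<Sum>i<K. ?mn i + ?mx i) + (P (Suc a) (Suc b) 0 - ?mx 0)" by (simp add: sum.distrib)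
    also have "(\<Sum>i<K. ?mn i + ?mx i) = (\<Sum>i<K. P (Suc a) b i + P a (Suc b) i)"
      by (intro sum.cong) (auto simp: min_def max_def)
    finally show ?thesis by (simp add: sum.distrib)
  qed
  have zc: "(\<Sum>i<K. P 0 a i) = 0" "(\<Sum>i<K. P a 0 i) = 0"
    if "a = Suc N \<or> a = Suc (Suc N)" for a
    using that by (auto intro!: sum.neutral z)
  have top: "level_sum K P (Suc (Suc N)) = (\<Sum>a\<le>N. \<Sum>i<K. P (Suc a) (Suc (N - a)) i)"
    unfolding level_sum_def sum.atMost_Suc_shift[of _ "Suc N"] using zc by (simp add: Suc_diff_le)
  have m1: "level_sum K P (Suc N) = (\<Sum>a\<le>N. \<Sum>i<K. P (Suc a) (N - a) i)"
    unfolding level_sum_def sum.atMost_Suc_shift[of _ N] using zc by simp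
  have m2: "level_sum K P (Suc N) = (\<Sum>a\<le>N. \<Sum>i<K. P a (Suc (N - a)) i)"
    unfolding level_sum_def using zc by (simp add: Suc_diff_le)
  have "level_sum K P (Suc (Suc N)) + level_sum K ?Q N
    = (\<Sum>a\<le>N. (\<Sum>i<K. P (Suc a) (Suc (N - a)) i) + (\<Sum>i<K. ?Q a (N - a) i))"
    unfolding top by (simp add: level_sum_def sum.distrib)
  also have "\<dots> = (\<Sum>a\<le>N. (\<Sum>i<K. P (Suc a) (N - a) i) + (\<Sum>i<K. P a (Suc (N - a)) i)
     + (P (Suc a) (Suc (N - a)) 0 - max (P (Suc a) (N - a) 0) (P a (Suc (N - a)) 0)))"
    by (intro sum.cong refl cell) auto
  also have "\<dots> = level_sum K P (Suc N) + level_sum K P (Suc N) +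
    (\<Sum>a\<le>N. P (Suc a) (Suc (N - a)) 0 - max (P (Suc a) (N - a) 0) (P a (Suc (N - a)) 0))"
    by (simp only: sum.distrib m1[symmetric] m2[symmetric])
  finally show ?thesis by simp
qed

text \<open>Solving the growth rule for the shape at the lower left corner of a unit square makes the
  growth process invertible, one antidiagonal at a time.\<close>
lemma growth_inverse:
  assumes "interlacing_levels N P" "Suc N \<le> K"
  shows "\<exists>w0. (\<forall>a b. 0 \<le> w0 a b) \<and>
    (\<forall>w. (\<forall>a b. 0 \<le> w a b) \<longrightarrow>
       (\<forall>a b i. a + b = N \<or> a + b = Suc N \<longrightarrow> lam w a b i = P a b i)
         \<longleftrightarrow> (\<forall>a b. a + b < N \<longrightarrow> w a b = w0 a b)) \<and>
    (\<Sum>m<N. \<Sum>a\<le>m. w0 a (m - a)) = level_sum K P (Suc N) - level_sum K P N"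
  using assms
proof (induction N arbitrary: P)
  case 0
  \<comment> \<open>The padded levels 0 and 1 contain only empty shapes, so they constrain no
    weight.\<close>
  have z: "P a b i = 0" if "a + b \<le> Suc 0" for a b i
  proof -
    have "a + b = 0 \<or> a + b = Suc 0" "min a b \<le> i" using that by (auto simp: min_def)
    then show ?thesis using 0 unfolding interlacing_levels_def by blast
  qed
  have "lam w a b i = P a b i" if "a + b = 0 \<or> a + b = Suc 0" for w a b i
    using that z[of a b i] by (cases a; cases b) auto
  moreover have "level_sum K P (Suc 0) - level_sum K P 0 = 0"
    by (simp add: level_sum_def z)
  ultimately show ?case by (intro exI[of _ "\<lambda>a b. 0"]) auto
next
  case (Suc N)
  let ?Q = "prev_level N P"
  have P: "\<And>a b i. a + b = Suc N \<Longrightarrow> P a b i \<le> P a (Suc b) i \<and> P a b i \<le> P (Suc a) b i"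
    and zP: "\<And>a b i. a + b = Suc (Suc N) \<Longrightarrow> min a b \<le> i \<Longrightarrow> P a b i = 0"
    using Suc.prems unfolding interlacing_levels_def by blast+
  obtain w1 where nn: "\<And>a b. 0 \<le> w1 a b"
    and eqv: "\<And>w. (\<forall>a b. 0 \<le> w a b) \<Longrightarrow>
       (\<forall>a b i. a + b = N \<or> a + b = Suc N \<longrightarrow> lam w a b i = ?Q a b i)
         \<longleftrightarrow> (\<forall>a b. a + b < N \<longrightarrow> w a b = w1 a b)"
    and sm: "(\<Sum>m<N. \<Sum>a\<le>m. w1 a (m - a)) = level_sum K ?Q (Suc N) - level_sum K ?Q N"
    using Suc.IH[OF interlacing_prev_level[OF Suc.prems(1)]] Suc.prems(2) by auto
  define corner where "corner a b = P (Suc a) (Suc b) 0 - max (P (Suc a) b 0) (P a (Suc b) 0)" for a b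
  define w0 where "w0 a b = (if a + b = N then corner a b else w1 a b)" for a b
  have "0 \<le> w0 a b" for a b
    using nn P[of a "Suc b"] P[of "Suc a" b] by (auto simp: w0_def corner_def)
  moreover have "(\<forall>a b i. a + b = Suc N \<or> a + b = Suc (Suc N) \<longrightarrow> lam w a b i = P a b i)
         \<longleftrightarrow> (\<forall>a b. a + b < Suc N \<longrightarrow> w a b = w0 a b)" if w: "\<forall>a b. 0 \<le> w a b" for w
  proof
    assume L: "\<forall>a b i. a + b = Suc N \<or> a + b = Suc (Suc N) \<longrightarrow> lam w a b i = P a b i"
    have "lam w a b i = ?Q a b i" if ab: "a + b = N" for a b i
    proof -
      have "lam w (Suc a) b j = P (Suc a) b j" "lam w a (Suc b) j = P a (Suc b) j"
        "lam w (Suc a) (Suc b) j = P (Suc a) (Suc b) j" for j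
        using L ab by auto
      then show ?thesis using lam.simps(4)[of w a b i] ab by (simp add: prev_level_def del: lam.simps)
    qed
    moreover have "lam w a b i = ?Q a b i" if ab: "a + b = Suc N" for a b i
      using L ab by (simp add: prev_level_def)
    ultimately have "\<forall>a b. a + b < N \<longrightarrow> w a b = w1 a b" using eqv[OF w] by blast
    moreover have "w a b = corner a b" if ab: "a + b = N" for a b
      using lam.simps(3)[of w a b] L ab by (simp add: corner_def del: lam.simps)
    ultimately show "\<forall>a b. a + b < Suc N \<longrightarrow> w a b = w0 a b" by (auto simp: w0_def less_Suc_eq)
  next
    assume R: "\<forall>a b. a + b < Suc N \<longrightarrow> w a b = w0 a b"
    then have "\<forall>a b. a + b < N \<longrightarrow> w a b = w1 a b" by (auto simp: w0_def)
    then have Q: "\<And>a b i. a + b = N \<or> a + b = Suc N \<Longrightarrow> lam w a b i = ?Q a b i"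
      using eqv[OF w] by blast
    have L1: "lam w a b i = P a b i" if "a + b = Suc N" for a b i
      using Q[of a b i] that by (simp add: prev_level_def)
    have "lam w a b i = P a b i" if ab: "a + b = Suc (Suc N)" for a b i
    proof (cases "a = 0 \<or> b = 0")
      case True
      then show ?thesis using zP[OF ab, of i] by auto
    next
      case False
      then obtain a' b' where s: "a = Suc a'" "b = Suc b'" by (auto simp: gr0_conv_Suc)
      have e: "a' + b' = N" using ab s by simp
      have "w a' b' = corner a' b'" using R e by (auto simp: w0_def)
      then show ?thesis
        using L1[of "Suc a'" b'] L1[of a' "Suc b'"] Q[of a' b'] e
        by (cases i) (auto simp: s corner_def prev_level_def)
    qed
    then show "\<forall>a b i. a + b = Suc N \<or> a + b = Suc (Suc N) \<longrightarrow> lam w a b i = P a b i"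
      using L1 by blast
  qed
  moreover have "(\<Sum>m<Suc N. \<Sum>a\<le>m. w0 a (m - a)) = level_sum K P (Suc (Suc N)) - level_sum K P (Suc N)"
  proof -
    have "(\<Sum>m<N. \<Sum>a\<le>m. w0 a (m - a)) = (\<Sum>m<N. \<Sum>a\<le>m. w1 a (m - a))"
      by (intro sum.cong) (auto simp: w0_def)
    moreover have "(\<Sum>a\<le>N. w0 a (N - a)) = (\<Sum>a\<le>N. corner a (N - a))"
      by (intro sum.cong) (auto simp: w0_def)
    moreover have "level_sum K ?Q (Suc N) = level_sum K P (Suc N)"
      unfolding level_sum_def by (intro sum.cong) (auto simp: prev_level_def)
    ultimately show ?thesis
      using sm level_sum_prev[OF Suc.prems(1), of K] Suc.prems(2) by (simp add: corner_def)
  qed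
  ultimately show ?case by blast
qed

section \<open>The joint law\<close>

text \<open>Padding sends (a, b, k) to (a+1, b+1, k-1) and thus raises the level by two;
  \<open>K\<close> is a cutoff beyond the last nonzero line.\<close>

lemma sum_Iset_eq_level_sum:
  assumes "m + 2 \<le> K"
  shows "(\<Sum>(a, b, k)\<in>Iset m. int (p a b k))
     = level_sum K (\<lambda>a b i. if i < min a b then int (p (a - 1) (b - 1) (Suc i)) else 0) (m + 2)"
proof -
  let ?P = "\<lambda>a b i. if i < min a b then int (p (a - 1) (b - 1) (Suc i)) else 0"
  let ?f = "\<lambda>(a, i). (a - 1, m + 2 - a - 1, Suc i)"
  let ?S = "{(a, i). a \<le> m + 2 \<and> i < min a (m + 2 - a)}"
  have "level_sum K ?P (m + 2) = (\<Sum>(a, i)\<in>{..m + 2} \<times> {..<K}. ?P a (m + 2 - a) i)"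
    unfolding level_sum_def by (rule sum.cartesian_product)
  also have "\<dots> = (\<Sum>(a, i)\<in>?S. ?P a (m + 2 - a) i)"
    using assms by (intro sum.mono_neutral_right) (auto split: if_splits)
  also have "\<dots> = (\<Sum>(a, b, k)\<in>Iset m. int (p a b k))"
  proof (rule sum.reindex_bij_witness[where j = ?f and i = "\<lambda>(a, b, k). (Suc a, k - 1)"])
    fix x assume "x \<in> ?S"
    then show "?f x \<in> Iset m" by (auto simp: Iset_def)
  qed (auto simp: Iset_def)
  finally show ?thesis ..
qed

text \<open>Inequalities that leave the index set compare with the zero padding and follow from
  nonnegativity.\<close>

lemma interlacing_levels_of_scriptI:
  assumes "in_scriptI n p"
  shows "interlacing_levels (n + 2)
    (\<lambda>a b i. if i < min a b then int (p (a - 1) (b - 1) (Suc i)) else 0)"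
proof -
  define J where "J = Iset n \<union> Iset (Suc n)"
  have mem: "(a, b, k) \<in> J \<longleftrightarrow> (a + b = n \<or> a + b = Suc n) \<and> 1 \<le> k \<and> k \<le> 1 + min a b" for a b k
    by (auto simp: J_def Iset_def)
  have I: "(a, b, k) \<in> J \<Longrightarrow> (Suc a, b, k) \<in> J \<Longrightarrow> p a b k \<le> p (Suc a) b k"
     "(a, b, k) \<in> J \<Longrightarrow> (Suc a, b, k) \<in> J \<Longrightarrow> (Suc a, b, Suc k) \<in> J \<Longrightarrow> p (Suc a) b (Suc k) \<le> p a b k"
     "(a, b, k) \<in> J \<Longrightarrow> (a, Suc b, k) \<in> J \<Longrightarrow> p a b k \<le> p a (Suc b) k"
     "(a, b, k) \<in> J \<Longrightarrow> (a, Suc b, k) \<in> J \<Longrightarrow> (a, Suc b, Suc k) \<in> J \<Longrightarrow> p a (Suc b) (Suc k) \<le> p a b k"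
    for a b k
    using assms unfolding in_scriptI_def Let_def J_def by blast+
  define P where "P a b i = (if i < min a b then int (p (a - 1) (b - 1) (Suc i)) else 0)" for a b i
  have "P a b i \<le> P (Suc a) b i \<and> P a b i \<le> P a (Suc b) i \<and>
        P (Suc a) b (Suc i) \<le> P a b i \<and> P a (Suc b) (Suc i) \<le> P a b i"
    if ab: "a + b = n + 2" for a b i
  proof (cases "i < min a b")
    case False
    then show ?thesis by (auto simp: P_def)
  next
    case True
    then obtain a' b' where s: "a = Suc a'" "b = Suc b'" by (cases a; cases b) auto
    then have e: "a' + b' = n" "i \<le> a'" "i \<le> b'" using ab True by auto
    show ?thesis
      using e I[of a' b' "Suc i"] by (auto simp: P_def s mem)
  qed
  moreover have "0 \<le> P a b i \<and> (min a b \<le> i \<longrightarrow> P a b i = 0)" for a b i by (auto simp: P_def)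
  ultimately show ?thesis unfolding interlacing_levels_def P_def by blast
qed

lemma card_triangle: "card {(a, b). a + b < (N::nat)} = N * (N + 1) div 2"
proof -
  have "{(a, b). a + b < N} = (SIGMA a:{..<N}. {..<N - a})" by auto
  then have "card {(a, b). a + b < N} = (\<Sum>a<N. N - a)" by simp
  also have "\<dots> = (\<Sum>a<N. Suc a)"
    by (rule sum.reindex_bij_witness[where i = "\<lambda>a. N - 1 - a" and j = "\<lambda>a. N - 1 - a"]) auto
  also have "\<dots> = N * (N + 1) div 2" by (induction N) auto
  finally show ?thesis .
qed

lemma sum_triangle:
  "(\<Sum>m<N. \<Sum>a\<le>m. f a (m - a)) = (\<Sum>(a, b)\<in>{(a, b). a + b < (N::nat)}. f a b)"
proof -
  have "(\<Sum>m<N. \<Sum>a\<le>m. f a (m - a)) = (\<Sum>(m, a)\<in>(SIGMA m:{..<N}. {..m}). f a (m - a))"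
    by (simp add: sum.Sigma)
  also have "\<dots> = (\<Sum>(a, b)\<in>{(a, b). a + b < N}. f a b)"
    by (rule sum.reindex_bij_witness[where i = "\<lambda>(a, b). (a + b, a)" and j = "\<lambda>(m, a). (a, m - a)"]) auto
  finally show ?thesis .
qed

lemma Wk_event_iff:
  fixes p :: "nat \<Rightarrow> nat \<Rightarrow> nat \<Rightarrow> nat"
  defines "P \<equiv> \<lambda>a b i. if i < min a b then int (p (a - 1) (b - 1) (Suc i)) else 0"
  shows "(\<forall>(a, b, k) \<in> Iset n \<union> Iset (Suc n). Wk \<omega> k (int a, int b) = int (p a b k)) \<longleftrightarrow>
    (\<forall>a b i. a + b = n + 2 \<or> a + b = Suc (n + 2) \<longrightarrow> lam (grid_weight \<omega>) a b i = P a b i)"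
    (is "?L \<longleftrightarrow> ?R")
proof
  interpret nonneg_weights "grid_weight \<omega>" by (rule nonneg_grid_weight)
  assume L: ?L
  show ?R
  proof (intro allI impI)
    fix a b i assume ab: "a + b = n + 2 \<or> a + b = Suc (n + 2)"
    show "lam (grid_weight \<omega>) a b i = P a b i"
    proof (cases "i < min a b")
      case True
      then obtain a' b' where s: "a = Suc a'" "b = Suc b'" by (cases a; cases b) auto
      then have "(a', b', Suc i) \<in> Iset n \<union> Iset (Suc n)" using ab True by (auto simp: Iset_def)
      then have "Wk \<omega> (Suc i) (int a', int b') = int (p a' b' (Suc i))" using L by blast
      then show ?thesis using True unfolding s P_def by (simp add: Wk_eq_lam)
    qed (auto simp: P_def lam_eq_0)
  qed
next
  assume R: ?R
  show ?L
  proof clarify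
    fix a b k assume "(a, b, k) \<in> Iset n \<union> Iset (Suc n)"
    then have ab: "Suc a + Suc b = n + 2 \<or> Suc a + Suc b = Suc (n + 2)" "1 \<le> k" "k \<le> 1 + min a b"
      by (auto simp: Iset_def)
    then obtain i where k: "k = Suc i" by (cases k) auto
    show "Wk \<omega> k (int a, int b) = int (p a b k)"
      using R ab unfolding k Wk_eq_lam by (auto simp: P_def)
  qed
qed

theorem theoremA2:
  fixes M :: "'w measure" and \<xi> :: "int \<times> int \<Rightarrow> 'w \<Rightarrow> nat"
    and \<beta> :: real and n :: nat and p :: "nat \<Rightarrow> nat \<Rightarrow> nat \<Rightarrow> nat"
  assumes "prob_space M"
    and "0 < \<beta>" and "\<beta> < 1"
    and "prob_space.indep_vars M (\<lambda>_. count_space UNIV) \<xi> UNIV"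
    and "\<And>v j. measure M {\<omega> \<in> space M. \<xi> v \<omega> = j} = (1 - \<beta>) * \<beta> ^ j"
    and "in_scriptI n p"
  shows "measure M {\<omega> \<in> space M. \<forall>(a, b, k) \<in> Iset n \<union> Iset (Suc n).
            Wk (\<lambda>z. \<xi> z \<omega>) k (int a, int b) = int (p a b k)}
         = (1 - \<beta>) ^ ((n + 2) * (n + 3) div 2) *
           \<beta> powi ((\<Sum>(a, b, k) \<in> Iset (Suc n). int (p a b k)) - (\<Sum>(a, b, k) \<in> Iset n. int (p a b k)))"
proof -
  interpret prob_space M by fact
  define P where "P = (\<lambda>a b i. if i < min a b then int (p (a - 1) (b - 1) (Suc i)) else 0)"
  have "interlacing_levels (n + 2) P"
    unfolding P_def by (rule interlacing_levels_of_scriptI) fact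
  then obtain w0 where nn: "\<And>a b. 0 \<le> w0 a b"
    and eqv: "\<And>w. (\<forall>a b. 0 \<le> w a b) \<Longrightarrow>
       (\<forall>a b i. a + b = n + 2 \<or> a + b = Suc (n + 2) \<longrightarrow> lam w a b i = P a b i)
         \<longleftrightarrow> (\<forall>a b. a + b < n + 2 \<longrightarrow> w a b = w0 a b)"
    and sm: "(\<Sum>m<n + 2. \<Sum>a\<le>m. w0 a (m - a)) = level_sum (n + 3) P (Suc (n + 2)) - level_sum (n + 3) P (n + 2)"
    using growth_inverse[of "n + 2" P "n + 3"] by auto
  define T where "T = {(a, b). a + b < n + 2}"
  have finT: "finite T"
    by (rule finite_subset[of _ "{..<n + 2} \<times> {..<n + 2}"]) (auto simp: T_def)
  define pos where "pos = (\<lambda>(a, b). (int a, int b))"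
  have "(0, 0) \<in> T" by (simp add: T_def)
  then have ne: "pos ` T \<noteq> {}" by blast
  have inj: "inj_on pos T" by (auto simp: pos_def inj_on_def)
  define target where "target v = nat (w0 (nat (fst v)) (nat (snd v)))" for v :: "int \<times> int"
  have event: "{\<omega> \<in> space M. \<forall>(a, b, k) \<in> Iset n \<union> Iset (Suc n).
            Wk (\<lambda>z. \<xi> z \<omega>) k (int a, int b) = int (p a b k)}
     = (\<Inter>v\<in>pos ` T. \<xi> v -` {target v} \<inter> space M)" (is "?E = ?I")
  proof -
    have "(\<forall>(a, b, k) \<in> Iset n \<union> Iset (Suc n). Wk (\<lambda>z. \<xi> z \<omega>) k (int a, int b) = int (p a b k))
      \<longleftrightarrow> (\<forall>v\<in>pos ` T. \<xi> v \<omega> = target v)" for \<omega>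
    proof -
      \<comment> \<open>The recovered weights are nonnegative, so \<open>nat\<close> in
        \<open>target\<close> loses no information.\<close>
      have cell: "grid_weight (\<lambda>z. \<xi> z \<omega>) a b = w0 a b \<longleftrightarrow> \<xi> (pos (a, b)) \<omega> = target (pos (a, b))" for a b
        using nn[of a b] by (auto simp: grid_weight_def pos_def target_def)
      have "(\<forall>(a, b, k) \<in> Iset n \<union> Iset (Suc n). Wk (\<lambda>z. \<xi> z \<omega>) k (int a, int b) = int (p a b k))
          \<longleftrightarrow> (\<forall>a b. a + b < n + 2 \<longrightarrow> grid_weight (\<lambda>z. \<xi> z \<omega>) a b = w0 a b)"
        unfolding Wk_event_iff
        by (rule eqv[unfolded P_def]) (simp add: grid_weight_def)
      also have "\<dots> \<longleftrightarrow> (\<forall>v\<in>pos ` T. \<xi> v \<omega> = target v)"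
        unfolding cell T_def by blast
      finally show ?thesis .
    qed
    then have "?E = {\<omega> \<in> space M. \<forall>v\<in>pos ` T. \<xi> v \<omega> = target v}" by simp
    then show ?thesis using ne by auto
  qed
  have "measure M ?I = (\<Prod>v\<in>pos ` T. measure M (\<xi> v -` {target v} \<inter> space M))"
    by (rule indep_varsD[OF assms(4)]) (use finT ne in auto)
  also have "\<dots> = (\<Prod>v\<in>pos ` T. (1 - \<beta>) * \<beta> ^ target v)"
  proof (rule prod.cong)
    fix v
    have "\<xi> v -` {target v} \<inter> space M = {\<omega> \<in> space M. \<xi> v \<omega> = target v}" by auto
    then show "measure M (\<xi> v -` {target v} \<inter> space M) = (1 - \<beta>) * \<beta> ^ target v"
      using assms(5)[of v "target v"] by simp
  qed simp
  also have "\<dots> = (1 - \<beta>) ^ card T * \<beta> ^ (\<Sum>x\<in>T. target (pos x))"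
    by (simp add: prod.reindex[OF inj] prod.distrib power_sum card_image[OF inj])
  also have "card T = (n + 2) * (n + 3) div 2"
    unfolding T_def card_triangle by (simp add: numeral_3_eq_3)
  also have "\<beta> ^ (\<Sum>x\<in>T. target (pos x)) = \<beta> powi int (\<Sum>x\<in>T. target (pos x))"
    by (rule power_int_of_nat[symmetric])
  also have "int (\<Sum>x\<in>T. target (pos x)) = (\<Sum>(a, b)\<in>T. w0 a b)"
    using nn by (auto simp: target_def pos_def intro!: sum.cong)
  also have "\<dots> = (\<Sum>(a, b, k) \<in> Iset (Suc n). int (p a b k)) - (\<Sum>(a, b, k) \<in> Iset n. int (p a b k))"
    using sm[unfolded sum_triangle[of w0 "n + 2"], folded T_def]
      sum_Iset_eq_level_sum[of n "n + 3" p] sum_Iset_eq_level_sum[of "Suc n" "n + 3" p]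
    by (simp add: P_def)
  finally show ?thesis unfolding event .
qed

end
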